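(* Let $g:\mathbb{R}^m\to\overline{\mathbb{R}}$ be proper and lower semicontinuous, let $F:\mathbb{R}^n\to\mathbb{R}^m$ be a $C^1$ mapping, and let $f(x)=(g\circ F)(x)$. Let $\bar x\in F^{-1}(\operatorname{dom} g)$ and $\bar v\in\partial f(\bar x)$ be such that $g$ is variationally convex at $F(\bar x)$ for every $\bar u\in\partial g(F(\bar x))$ satisfying $\bar v=\nabla F(\bar x)^*\bar u$. Define the set-valued mapping $$S:\mathbb{R}^n\times\mathbb{R}^n\rightrightarrows\mathbb{R}^m,\qquad S(x,v)=\{u\in\partial g(F(x)) : v=\nabla F(x)^*u\}.$$ Suppose that the constraint qualification $$\ker\nabla F(\bar x)^*\cap\partial^\infty g(F(\bar x))=\{0\}$$ is satisfied and that there exist open convex neighborhoods $U\ni\bar x$ and $V\ni\bar v$, and $\varepsilon>0$ such that, with $U_\varepsilon=\{x\in U: f(x)<f(\bar x)+\varepsilon\}$, for every $(x,v)\in\operatorname{gph}\partial f\cap[U_\varepsilon\times V]$ and every $u\in S(x,v)$, $$\langle u,F(\cdot)\rangle\ \text{ is convex on } U.$$ Then $f$ is variationally convex at $\bar x$ for $\bar v\in\partial f(\bar x)$.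
   Context: $\overline{\mathbb{R}}=[-\infty,+\infty]$; $f$ is proper if $f>-\infty$ and $f\not\equiv+\infty$; $\operatorname{dom} f=\{x: f(x)<+\infty\}$. $\nabla F(x)$ is the Jacobian and $\nabla F(x)^*$ its adjoint (transpose). For $\bar x\in\operatorname{dom}f$: the regular subdifferential is $\widehat\partial f(\bar x)=\{v:\liminf_{x\to\bar x,\,x\ne\bar x}\frac{f(x)-f(\bar x)-\langle v,x-\bar x\rangle}{\|x-\bar x\|}\ge0\}$; the limiting subdifferential $\partial f(\bar x)$ is the set of limits $v=\lim v_k$ with $v_k\in\widehat\partial f(x_k)$, $x_k\to\bar x$, $f(x_k)\to f(\bar x)$; the horizon subdifferential $\partial^\infty f(\bar x)$ is the set of limits $v=\lim\lambda_kv_k$ with $\lambda_k\downarrow0$, $v_k\in\widehat\partial f(x_k)$, $x_k\to\bar x$, $f(x_k)\to f(\bar x)$. Subdifferentials are empty off $\operatorname{dom}f$. $\operatorname{gph}\partial f=\{(x,v): v\in\partial f(x)\}$. Variational convexity: a proper lsc $f$ is variationally convex at $\bar x\in\operatorname{dom}f$ for $\bar v\in\partial f(\bar x)$ if there exist open convex neighborhoods $U$ of $\bar x$ and $V$ of $\bar v$, a convex lsc function $\hat f$ with values in $\overline{\mathbb{R}}$ with $\hat f\le f$ on $U$, and $\varepsilon>0$ such that $[U_\varepsilon\times V]\cap\operatorname{gph}\partial f=[U\times V]\cap\operatorname{gph}\partial\hat f$, where $U_\varepsilon=\{x\in U: f(x)<f(\bar x)+\varepsilon\}$, and moreover $f(x)=\hat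 f(x)$ for every $(x,v)$ in this common graph. *)

theory Defs
  imports "HOL-Analysis.Analysis"
begin

definition eff_dom :: "('a \<Rightarrow> ereal) \<Rightarrow> 'a set" where
  "eff_dom f = {x. f x < \<infinity>}"

definition proper_fun :: "('a \<Rightarrow> ereal) \<Rightarrow> bool" where
  "proper_fun f \<longleftrightarrow> (\<forall>x. f x > -\<infinity>) \<and> (\<exists>x. f x \<noteq> \<infinity>)"

definition lsc_fun :: "('a::topological_space \<Rightarrow> ereal) \<Rightarrow> bool" where
  "lsc_fun f \<longleftrightarrow> (\<forall>x. f x \<le> Liminf (at x) f)"

text \<open>Convexity of an extended-real-valued function is convexity of its epigraph in the
  product with the (finite) real line; this avoids expressions of the form \<open>\<infinity> - \<infinity>\<close> for
  functions that also take the value \<open>-\<infinity>\<close>.\<close>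

definition convex_fun :: "('a::real_vector \<Rightarrow> ereal) \<Rightarrow> bool" where
  "convex_fun f \<longleftrightarrow> convex {(x, r :: real). f x \<le> ereal r}"

text \<open>All three subdifferentials are empty at points where the function is not finite. For
  functions that never take the value \<open>-\<infinity>\<close> these are exactly the points outside
  \<open>eff_dom f\<close>; at points with value \<open>-\<infinity>\<close> the difference quotient has no meaning.\<close>

definition regular_subdiff :: "('a::euclidean_space \<Rightarrow> ereal) \<Rightarrow> 'a \<Rightarrow> 'a set" where
  "regular_subdiff f x =
     {v. \<bar>f x\<bar> \<noteq> \<infinity> \<and>
         0 \<le> Liminf (at x) (\<lambda>y. (f y - f x - ereal (v \<bullet> (y - x))) / ereal (norm (y - x)))}"

definition limiting_subdiff :: "('a::euclidean_space \<Rightarrow> ereal) \<Rightarrow> 'a \<Rightarrow> 'a set" where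
  "limiting_subdiff f x =
     {v. \<bar>f x\<bar> \<noteq> \<infinity> \<and>
         (\<exists>xs vs. (\<forall>k::nat. vs k \<in> regular_subdiff f (xs k)) \<and>
            xs \<longlonglongrightarrow> x \<and> (\<lambda>k. f (xs k)) \<longlonglongrightarrow> f x \<and> vs \<longlonglongrightarrow> v)}"

definition horizon_subdiff :: "('a::euclidean_space \<Rightarrow> ereal) \<Rightarrow> 'a \<Rightarrow> 'a set" where
  "horizon_subdiff f x =
     {v. \<bar>f x\<bar> \<noteq> \<infinity> \<and>
         (\<exists>l xs vs. (\<forall>k::nat. l k > (0::real)) \<and> l \<longlonglongrightarrow> 0 \<and>
            (\<forall>k. vs k \<in> regular_subdiff f (xs k)) \<and>
            xs \<longlonglongrightarrow> x \<and> (\<lambda>k. f (xs k)) \<longlonglongrightarrow> f x \<and> (\<lambda>k. l k *\<^sub>R vs k) \<longlonglongrightarrow> v)}"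

definition gph_subdiff :: "('a::euclidean_space \<Rightarrow> ereal) \<Rightarrow> ('a \<times> 'a) set" where
  "gph_subdiff f = {(x, v). v \<in> limiting_subdiff f x}"

definition sublevel_nbhd :: "('a \<Rightarrow> ereal) \<Rightarrow> 'a \<Rightarrow> 'a set \<Rightarrow> real \<Rightarrow> 'a set" where
  "sublevel_nbhd f xb U \<epsilon> = {x \<in> U. f x < f xb + ereal \<epsilon>}"

definition variationally_convex ::
  "('a::euclidean_space \<Rightarrow> ereal) \<Rightarrow> 'a \<Rightarrow> 'a \<Rightarrow> bool" where
  "variationally_convex f xb vb \<longleftrightarrow>
     proper_fun f \<and> lsc_fun f \<and> xb \<in> eff_dom f \<and> vb \<in> limiting_subdiff f xb \<and>
     (\<exists>U V fh \<epsilon>.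
        open U \<and> convex U \<and> xb \<in> U \<and>
        open V \<and> convex V \<and> vb \<in> V \<and>
        convex_fun fh \<and> lsc_fun fh \<and> (\<forall>x\<in>U. fh x \<le> f x) \<and>
        \<epsilon> > 0 \<and>
        (sublevel_nbhd f xb U \<epsilon> \<times> V) \<inter> gph_subdiff f = (U \<times> V) \<inter> gph_subdiff fh \<and>
        (\<forall>(x, v) \<in> (U \<times> V) \<inter> gph_subdiff fh. f x = fh x))"

definition C1_mapping :: "(real ^ 'n \<Rightarrow> real ^ 'm) \<Rightarrow> bool" where
  "C1_mapping F \<longleftrightarrow>
     (\<forall>x. F differentiable (at x)) \<and> continuous_on UNIV (\<lambda>x. jacobian F (at x))"

definition multiplier_map ::
  "(real ^ 'm \<Rightarrow> ereal) \<Rightarrow> (real ^ 'n \<Rightarrow> real ^ 'm) \<Rightarrow>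
     (real ^ 'n) \<times> (real ^ 'n) \<Rightarrow> (real ^ 'm) set" where
  "multiplier_map g F =
     (\<lambda>(x, v). {u \<in> limiting_subdiff g (F x). v = transpose (jacobian F (at x)) *v u})"

end

theory Submission
  imports Defs
begin

text \<open>Variational convexity of \<open>f\<close> at \<open>xb\<close> for \<open>vb\<close> is equivalent to the local support inequality
  \<open>f x + v \<bullet> (y - x) \<le> f y\<close> for all \<open>y\<close> near \<open>xb\<close> and all \<open>(x, v)\<close> in an \<open>f\<close>-attentive localisation
  of the subdifferential graph. The supremum of these affine minorants serves as the convex function
  \<open>fh\<close>; a local resolvent argument together with monotonicity of \<open>\<partial>fh\<close> shows that the graph
  of \<open>\<partial>fh\<close> is locally no larger than that of \<open>\<partial>f\<close>.

  For \<open>f = g \<circ> F\<close> suppose the inequality fails along \<open>(x\<^sub>k, v\<^sub>k) \<rightarrow> (xb, vb)\<close> and \<open>y\<^sub>k \<rightarrow> xb\<close>. The constraint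
  qualification yields bounded multipliers \<open>u\<^sub>k \<in> S(x\<^sub>k, v\<^sub>k)\<close>, which cluster at some \<open>ub \<in> S(xb, vb)\<close>.
  The support inequality of \<open>g\<close> at \<open>(F xb, ub)\<close>, combined with the gradient inequality for the convex
  function \<open>u\<^sub>k \<bullet> F\<close>, then gives a contradiction.\<close>

section \<open>Lower semicontinuity and subgradients\<close>

text \<open>\<open>Liminf (at x)\<close> omits \<open>x\<close>, but the bound required at
  \<open>x\<close> is \<open>c < f x\<close> itself, so \<open>nhds x\<close> can replace
  \<open>at x\<close>. Sequences that hit \<open>x\<close> then need no separate case.\<close>

lemma lsc_fun_iff:
  "lsc_fun f \<longleftrightarrow> (\<forall>x c. c < f x \<longrightarrow> (\<forall>\<^sub>F y in nhds x. c < f y))"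
proof -
  have "f x \<le> Liminf (at x) f \<longleftrightarrow> (\<forall>c. c < f x \<longrightarrow> (\<forall>\<^sub>F y in nhds x. c < f y))" for x
    unfolding le_Liminf_iff eventually_nhds_conv_at by auto
  then show ?thesis unfolding lsc_fun_def by simp
qed

lemma lsc_funD: "lsc_fun f \<Longrightarrow> c < f x \<Longrightarrow> \<forall>\<^sub>F y in nhds x. c < f y"
  by (simp add: lsc_fun_iff)

lemma lsc_fun_seq_le:
  assumes "lsc_fun f" "z \<longlonglongrightarrow> x" "\<And>n. f (z n) \<le> c n" "c \<longlonglongrightarrow> l"
  shows "f x \<le> (l::ereal)"
proof (rule ccontr)
  assume "\<not> f x \<le> l"
  then obtain d where d: "l < d" "d < f x" using dense by (metis not_le)
  from lsc_funD[OF assms(1) d(2)] assms(2)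
  have "\<forall>\<^sub>F n in sequentially. d < f (z n)" by (rule eventually_compose_filterlim)
  moreover have "\<forall>\<^sub>F n in sequentially. c n < d" using order_tendstoD(2)[OF assms(4) d(1)] .
  ultimately have "\<forall>\<^sub>F n in sequentially. False"
    by eventually_elim (meson assms(3) leD less_le_trans less_trans)
  then show False by simp
qed

lemma continuous_on_UNIV_tendsto_nhds:
  assumes "continuous_on UNIV F"
  shows "(F \<longlongrightarrow> F x) (nhds x)"
  using assms unfolding tendsto_at_iff_tendsto_nhds[symmetric] continuous_on_def by simp

lemma lsc_fun_compose:
  assumes "lsc_fun g" "continuous_on UNIV F"
  shows "lsc_fun (g \<circ> F)"
  unfolding lsc_fun_iff
proof (intro allI impI)
  fix x c assume "c < (g \<circ> F) x"
  then have "\<forall>\<^sub>F y in nhds (F x). c < g y" using lsc_funD[OF assms(1)] by simp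
  moreover have "filterlim F (nhds (F x)) (nhds x)"
    by (rule continuous_on_UNIV_tendsto_nhds[OF assms(2)])
  ultimately show "\<forall>\<^sub>F y in nhds x. c < (g \<circ> F) y"
    using eventually_compose_filterlim by fastforce
qed

lemma lsc_fun_add_continuous:
  assumes "lsc_fun h" "continuous_on UNIV q"
  shows "lsc_fun (\<lambda>z. h z + ereal (q z))"
  unfolding lsc_fun_iff
proof (intro allI impI)
  fix x c assume "c < h x + ereal (q x)"
  \<comment> \<open>Two reals are inserted below the sum: the gap \<open>e - d\<close> is the loss
    allowed to \<open>q\<close>, and \<open>e - q x\<close> is the lower bound that \<open>h\<close>
    keeps near \<open>x\<close>.\<close>
  then obtain d where d: "c < ereal d" "ereal d < h x + ereal (q x)" using ereal_dense2 by blast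
  then obtain e where e: "ereal d < ereal e" "ereal e < h x + ereal (q x)" using ereal_dense2 by blast
  have "ereal (e - q x) < h x" using e(2) by (cases "h x") auto
  from lsc_funD[OF assms(1) this] have "\<forall>\<^sub>F y in nhds x. ereal (e - q x) < h y" .
  moreover have "\<forall>\<^sub>F y in nhds x. q x - (e - d) < q y"
    using order_tendstoD(1)[OF continuous_on_UNIV_tendsto_nhds[OF assms(2)]] e(1) by simp
  ultimately show "\<forall>\<^sub>F y in nhds x. c < h y + ereal (q y)"
  proof eventually_elim
    case (elim y)
    have "ereal d < h y + ereal (q y)" using elim e by (cases "h y") auto
    with d(1) show ?case by (rule less_trans)
  qed
qed

text \<open>Direct method: a minimising sequence has a subsequence converging in \<open>K\<close>,
  and \<open>lsc_fun_seq_le\<close> compares the value at its limit with the infimum. The minimum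
  may be infinite; finiteness is established where the lemma is applied.\<close>

lemma lsc_fun_attains_min:
  fixes f :: "'a::metric_space \<Rightarrow> ereal"
  assumes "lsc_fun f" "compact K" "K \<noteq> {}"
  obtains x where "x \<in> K" "\<And>y. y \<in> K \<Longrightarrow> f x \<le> f y"
proof -
  have "f ` K \<noteq> {}" using assms(3) by simp
  from Inf_as_limit[OF this] obtain u where u: "\<And>n. u n \<in> f ` K" "u \<longlonglongrightarrow> Inf (f ` K)" by blast
  then have "\<forall>n. \<exists>z. z \<in> K \<and> u n = f z" by blast
  then obtain z where z: "\<And>n. z n \<in> K" "\<And>n. u n = f (z n)" by metis
  obtain x r where x: "x \<in> K" "strict_mono r" "(z \<circ> r) \<longlonglongrightarrow> x"
    using assms(2) z(1) unfolding compact_def by blast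
  have "f x \<le> Inf (f ` K)"
    using lsc_fun_seq_le[OF assms(1) x(3), of "u \<circ> r"] z(2) LIMSEQ_subseq_LIMSEQ[OF u(2) x(2)]
    by simp
  with that[OF x(1)] show thesis by (meson INF_lower order_trans)
qed

section \<open>Regular, limiting and proximal subgradients\<close>

text \<open>Multiplying by \<open>norm (y - x)\<close> replaces the quotient of extended reals by an
  affine lower bound with error \<open>e * norm (y - x)\<close>. At \<open>y = x\<close> this bound
  holds with equality, hence the full neighbourhood \<open>nhds x\<close>.\<close>

lemma regular_subdiff_iff:
  "v \<in> regular_subdiff f x \<longleftrightarrow>
     (\<exists>a. f x = ereal a \<and>
        (\<forall>e>0. \<forall>\<^sub>F y in nhds x. ereal (a + v \<bullet> (y - x) - e * norm (y - x)) \<le> f y))"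
proof (cases "f x")
  case (real a)
  have quot: "ereal c < (f y - f x - ereal (v \<bullet> (y - x))) / ereal (norm (y - x)) \<longleftrightarrow>
       ereal (a + v \<bullet> (y - x) + c * norm (y - x)) < f y" if "y \<noteq> x" for c y
    using that real by (cases "f y") (auto simp: field_simps)
  have "v \<in> regular_subdiff f x \<longleftrightarrow>
     (\<forall>c<0. \<forall>\<^sub>F y in at x. c < (f y - f x - ereal (v \<bullet> (y - x))) / ereal (norm (y - x)))"
    unfolding regular_subdiff_def le_Liminf_iff using real by simp
  also have "\<dots> \<longleftrightarrow> (\<forall>e>0. \<forall>\<^sub>F y in at x. ereal (- e) < (f y - f x - ereal (v \<bullet> (y - x))) / ereal (norm (y - x)))"
  proof (intro iffI allI impI)
    fix c :: ereal assume c: "c < 0" and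
      H: "\<forall>e>0. \<forall>\<^sub>F y in at x. ereal (- e) < (f y - f x - ereal (v \<bullet> (y - x))) / ereal (norm (y - x))"
    obtain d where d: "c < ereal d" "ereal d < 0" using ereal_dense2[OF c] by blast
    have "- d > 0" using d(2) by simp
    from H[rule_format, OF this] show "\<forall>\<^sub>F y in at x. c < (f y - f x - ereal (v \<bullet> (y - x))) / ereal (norm (y - x))"
      by eventually_elim (use less_trans[OF d(1)] in simp)
  qed auto
  also have "\<dots> \<longleftrightarrow> (\<forall>e>0. \<forall>\<^sub>F y in at x. ereal (a + v \<bullet> (y - x) - e * norm (y - x)) < f y)"
  proof -
    have "(\<forall>\<^sub>F y in at x. ereal (- e) < (f y - f x - ereal (v \<bullet> (y - x))) / ereal (norm (y - x))) \<longleftrightarrow>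
      (\<forall>\<^sub>F y in at x. ereal (a + v \<bullet> (y - x) - e * norm (y - x)) < f y)" for e
      unfolding eventually_at_filter by (rule eventually_cong[OF eventually_True]) (use quot[of _ "-e"] in auto)
    then show ?thesis by simp
  qed
  also have "\<dots> \<longleftrightarrow> (\<forall>e>0. \<forall>\<^sub>F y in nhds x. ereal (a + v \<bullet> (y - x) - e * norm (y - x)) \<le> f y)"
  proof (intro iffI allI impI)
    fix e :: real assume e: "e > 0"
      and H: "\<forall>e>0. \<forall>\<^sub>F y in at x. ereal (a + v \<bullet> (y - x) - e * norm (y - x)) < f y"
    show "\<forall>\<^sub>F y in nhds x. ereal (a + v \<bullet> (y - x) - e * norm (y - x)) \<le> f y"
      using H[rule_format, OF e] unfolding eventually_at_filter
    proof eventually_elim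
      case (elim y)
      then show ?case using real by (cases "y = x") (auto simp: less_imp_le)
    qed
  next
    fix e :: real assume e: "e > 0"
      and H: "\<forall>e>0. \<forall>\<^sub>F y in nhds x. ereal (a + v \<bullet> (y - x) - e * norm (y - x)) \<le> f y"
    have "\<forall>\<^sub>F y in nhds x. ereal (a + v \<bullet> (y - x) - (e/2) * norm (y - x)) \<le> f y"
      using H[rule_format, of "e/2"] e by simp
    then show "\<forall>\<^sub>F y in at x. ereal (a + v \<bullet> (y - x) - e * norm (y - x)) < f y"
      unfolding eventually_at_filter
    proof eventually_elim
      case (elim y)
      have "y \<noteq> x \<Longrightarrow> ereal (a + v \<bullet> (y - x) - e * norm (y - x)) < ereal (a + v \<bullet> (y - x) - (e/2) * norm (y - x))"
        using e by simp
      then show ?case using elim less_le_trans by blast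
    qed
  qed
  finally show ?thesis using real by simp
qed (auto simp: regular_subdiff_def)

lemma regular_subdiff_finite: "v \<in> regular_subdiff f x \<Longrightarrow> \<bar>f x\<bar> \<noteq> \<infinity>"
  by (simp add: regular_subdiff_def)

lemma limiting_subdiff_finite: "v \<in> limiting_subdiff f x \<Longrightarrow> \<bar>f x\<bar> \<noteq> \<infinity>"
  by (simp add: limiting_subdiff_def)

lemma regular_subset_limiting_subdiff: "regular_subdiff f x \<subseteq> limiting_subdiff f x"
proof
  fix v assume v: "v \<in> regular_subdiff f x"
  with regular_subdiff_finite[OF v] show "v \<in> limiting_subdiff f x"
    unfolding limiting_subdiff_def
    by (intro CollectI conjI exI[of _ "\<lambda>_. x"] exI[of _ "\<lambda>_. v"]) auto
qed

lemma tendsto_inverse_Suc_dist: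
  fixes z :: "nat \<Rightarrow> 'a::metric_space"
  assumes "\<And>k. dist (z k) (w k) < inverse (real (Suc k))" "w \<longlonglongrightarrow> l"
  shows "z \<longlonglongrightarrow> l"
proof -
  have "(\<lambda>k. dist (z k) (w k)) \<longlonglongrightarrow> 0"
  proof (rule tendsto_sandwich[OF _ _ tendsto_const LIMSEQ_inverse_real_of_nat])
    show "\<forall>\<^sub>F k in sequentially. dist (z k) (w k) \<le> inverse (real (Suc k))"
      by (rule always_eventually) (rule allI, rule less_imp_le, rule assms(1))
  qed simp
  then have "(\<lambda>k. dist (z k) (w k) + dist (w k) l) \<longlonglongrightarrow> 0"
    using assms(2) unfolding tendsto_dist_iff[of w] by (rule tendsto_add_zero)
  then show ?thesis unfolding tendsto_dist_iff[of z]
  proof (rule tendsto_sandwich[OF _ _ tendsto_const, rotated 2])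
    show "\<forall>\<^sub>F k in sequentially. dist (z k) l \<le> dist (z k) (w k) + dist (w k) l"
      by (rule always_eventually) (rule allI, rule dist_triangle)
  qed simp
qed

text \<open>Approximation at every scale \<open>e\<close> replaces the sequences of the definition,
  so diagonal arguments become estimates with \<open>e/2\<close>.\<close>

lemma limiting_subdiff_iff:
  "v \<in> limiting_subdiff f x \<longleftrightarrow>
     (\<exists>a. f x = ereal a \<and>
       (\<forall>e>0. \<exists>x' v' a'. v' \<in> regular_subdiff f x' \<and> f x' = ereal a' \<and>
          dist x' x < e \<and> dist a' a < e \<and> dist v' v < e))"
  (is "_ \<longleftrightarrow> ?R")
proof
  assume "v \<in> limiting_subdiff f x"
  then obtain xs vs where fin: "\<bar>f x\<bar> \<noteq> \<infinity>"
    and 1: "\<And>k. vs k \<in> regular_subdiff f (xs k)"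
      "xs \<longlonglongrightarrow> x" "(\<lambda>k. f (xs k)) \<longlonglongrightarrow> f x" "vs \<longlonglongrightarrow> v"
    unfolding limiting_subdiff_def mem_Collect_eq by metis
  obtain a where a: "f x = ereal a" using fin by auto
  have "\<forall>k. \<exists>b. f (xs k) = ereal b" using regular_subdiff_finite[OF 1(1)] by (metis ereal_real)
  then obtain b where b: "\<And>k. f (xs k) = ereal (b k)" by metis
  have b': "b \<longlonglongrightarrow> a" using 1(3) b a by simp
  show ?R
  proof (intro exI[of _ a] conjI allI impI a)
    fix e :: real assume "e > 0"
    have "\<forall>\<^sub>F k in sequentially. dist (xs k) x < e \<and> dist (b k) a < e \<and> dist (vs k) v < e"
      using tendstoD[OF 1(2) \<open>e > 0\<close>] tendstoD[OF b' \<open>e > 0\<close>] tendstoD[OF 1(4) \<open>e > 0\<close>]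
      by eventually_elim auto
    then obtain k where "dist (xs k) x < e \<and> dist (b k) a < e \<and> dist (vs k) v < e"
      using eventually_happens by force
    then show "\<exists>x' v' a'. v' \<in> regular_subdiff f x' \<and> f x' = ereal a' \<and>
          dist x' x < e \<and> dist a' a < e \<and> dist v' v < e"
      using 1(1) b by blast
  qed
next
  assume ?R
  then obtain a where a: "f x = ereal a" and
    H: "\<And>e. e>0 \<Longrightarrow> \<exists>x' v' a'. v' \<in> regular_subdiff f x' \<and> f x' = ereal a' \<and>
          dist x' x < e \<and> dist a' a < e \<and> dist v' v < e" by blast
  have "\<forall>k. \<exists>x' v' a'. v' \<in> regular_subdiff f x' \<and> f x' = ereal a' \<and>
          dist x' x < inverse (real (Suc k)) \<and> dist a' a < inverse (real (Suc k)) \<and> dist v' v < inverse (real (Suc k))"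
    by (intro allI H) simp
  then obtain xs vs b where 1: "\<And>k. vs k \<in> regular_subdiff f (xs k)" "\<And>k. f (xs k) = ereal (b k)"
      "\<And>k. dist (xs k) x < inverse (real (Suc k))" "\<And>k. dist (b k) a < inverse (real (Suc k))"
      "\<And>k. dist (vs k) v < inverse (real (Suc k))" by metis
  have "xs \<longlonglongrightarrow> x" "b \<longlonglongrightarrow> a" "vs \<longlonglongrightarrow> v"
    using tendsto_inverse_Suc_dist[OF 1(3) tendsto_const] tendsto_inverse_Suc_dist[OF 1(4) tendsto_const]
      tendsto_inverse_Suc_dist[OF 1(5) tendsto_const] by auto
  then show "v \<in> limiting_subdiff f x"
    unfolding limiting_subdiff_def mem_Collect_eq using 1(1,2) a
    by (intro conjI exI[of _ xs] exI[of _ vs]) auto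
qed

text \<open>Diagonal argument at scale \<open>e/2\<close>: first an index \<open>k\<close> near the
  limit, then a regular subgradient near \<open>us k\<close>. The values must converge too, since
  the closure is \<open>f\<close>-attentive.\<close>

lemma limiting_subdiff_closed:
  assumes "\<And>k. us k \<in> limiting_subdiff f (ys k)" "ys \<longlonglongrightarrow> y"
    "(\<lambda>k. f (ys k)) \<longlonglongrightarrow> f y" "us \<longlonglongrightarrow> u" "\<bar>f y\<bar> \<noteq> \<infinity>"
  shows "u \<in> limiting_subdiff f y"
proof -
  obtain b where b: "f y = ereal b" using assms(5) by auto
  have "\<forall>k. \<exists>a. f (ys k) = ereal a" using limiting_subdiff_finite[OF assms(1)] by (metis ereal_real)
  then obtain a where a: "\<And>k. f (ys k) = ereal (a k)" by metis
  have a': "a \<longlonglongrightarrow> b" using assms(3) a b by simp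
  show ?thesis unfolding limiting_subdiff_iff
  proof (intro exI[of _ b] conjI allI impI b)
    fix e :: real assume "e > 0"
    then have e2: "e/2 > 0" by simp
    have "\<forall>\<^sub>F k in sequentially. dist (ys k) y < e/2 \<and> dist (a k) b < e/2 \<and> dist (us k) u < e/2"
      using tendstoD[OF assms(2) e2] tendstoD[OF a' e2] tendstoD[OF assms(4) e2]
      by eventually_elim auto
    then obtain k where k: "dist (ys k) y < e/2 \<and> dist (a k) b < e/2 \<and> dist (us k) u < e/2"
      using eventually_happens by force
    obtain x' v' a' where n: "v' \<in> regular_subdiff f x' \<and> f x' = ereal a' \<and>
          dist x' (ys k) < e/2 \<and> dist a' (a k) < e/2 \<and> dist v' (us k) < e/2"
      using assms(1)[of k] e2 a[of k] unfolding limiting_subdiff_iff by (metis ereal.inject)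
    then have "dist x' y < e \<and> dist a' b < e \<and> dist v' u < e"
      using k dist_triangle_half_r[of "ys k" x' e y] dist_triangle_half_r[of "a k" a' e b]
        dist_triangle_half_r[of "us k" v' e u] by (simp add: dist_commute)
    with n show "\<exists>x' v' a'. v' \<in> regular_subdiff f x' \<and> f x' = ereal a' \<and>
          dist x' y < e \<and> dist a' b < e \<and> dist v' u < e"
      by blast
  qed
qed

text \<open>A quadratic error is at most \<open>e * norm (y - x)\<close> once
  \<open>norm (y - x)\<close> is less than \<open>e / (\<bar>c\<bar> + 1)\<close>; the
  \<open>+ 1\<close> also covers \<open>c = 0\<close>.\<close>

lemma regular_subdiff_proximal:
  assumes "f x = ereal a" "\<forall>\<^sub>F y in nhds x. ereal (a + v \<bullet> (y - x) - c * (norm (y - x))\<^sup>2) \<le> f y"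
  shows "v \<in> regular_subdiff f x"
  unfolding regular_subdiff_iff
proof (intro exI[of _ a] conjI allI impI assms(1))
  fix e :: real assume e: "e > 0"
  have "\<forall>\<^sub>F y in nhds x. dist y x < e / (\<bar>c\<bar> + 1)"
    using e by (auto simp: eventually_nhds_metric intro!: exI[of _ "e / (\<bar>c\<bar> + 1)"])
  with assms(2) show "\<forall>\<^sub>F y in nhds x. ereal (a + v \<bullet> (y - x) - e * norm (y - x)) \<le> f y"
  proof eventually_elim
    case (elim y)
    have "(\<bar>c\<bar> + 1) * norm (y - x) \<le> e" using elim(2) by (simp add: dist_norm field_simps)
    moreover have "c * norm (y - x) \<le> (\<bar>c\<bar> + 1) * norm (y - x)" by (intro mult_right_mono) auto
    ultimately have "c * norm (y - x) \<le> e" by linarith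
    then have "c * (norm (y - x))\<^sup>2 \<le> e * norm (y - x)"
      using mult_right_mono[of "c * norm (y - x)" e "norm (y - x)"] by (simp add: power2_eq_square mult.assoc)
    then have "ereal (a + v \<bullet> (y - x) - e * norm (y - x)) \<le> ereal (a + v \<bullet> (y - x) - c * (norm (y - x))\<^sup>2)"
      by simp
    then show ?case using elim(1) by (rule order_trans)
  qed
qed

lemma ereal_le_of_le_add:
  assumes "ereal p \<le> F + ereal q" "r \<le> p - q"
  shows "ereal r \<le> F"
  using assms by (cases F) auto

text \<open>Fermat rule for a quadratic penalty: expanding the square of \<open>norm (y - p)\<close>
  about \<open>x\<close> leaves a linear term, which yields the subgradient, and a quadratic error
  that \<open>regular_subdiff_proximal\<close> absorbs.\<close>

lemma regular_subdiff_proximal_min: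
  assumes "f x = ereal a" "d > 0"
    "\<And>y. dist y x < d \<Longrightarrow> f x + ereal (k / 2 * (norm (x - p))\<^sup>2) \<le> f y + ereal (k / 2 * (norm (y - p))\<^sup>2)"
  shows "k *\<^sub>R (p - x) \<in> regular_subdiff f x"
proof (rule regular_subdiff_proximal[where a = a and c = "k/2"])
  have "\<forall>\<^sub>F y in nhds x. dist y x < d"
    using assms(2) by (auto simp: eventually_nhds_metric)
  then show "\<forall>\<^sub>F y in nhds x. ereal (a + (k *\<^sub>R (p - x)) \<bullet> (y - x) - k / 2 * (norm (y - x))\<^sup>2) \<le> f y"
  proof eventually_elim
    case (elim y)
    have "(norm (y - p))\<^sup>2 = (norm (x - p))\<^sup>2 + (norm (y - x))\<^sup>2 - 2 * ((p - x) \<bullet> (y - x))"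
      unfolding power2_norm_eq_inner by (simp add: inner_diff_left inner_diff_right inner_commute)
    then have eq: "k / 2 * (norm (y - p))\<^sup>2 =
        k / 2 * (norm (x - p))\<^sup>2 + k / 2 * (norm (y - x))\<^sup>2 - (k *\<^sub>R (p - x)) \<bullet> (y - x)"
      by (simp add: inner_scaleR_left distrib_left right_diff_distrib)
    have "ereal (a + k / 2 * (norm (x - p))\<^sup>2) \<le> f y +
        ereal (k / 2 * (norm (x - p))\<^sup>2 + k / 2 * (norm (y - x))\<^sup>2 - (k *\<^sub>R (p - x)) \<bullet> (y - x))"
      using assms(3)[OF elim] unfolding eq assms(1) by simp
    then show ?case
      by (rule ereal_le_of_le_add) simp
  qed
qed (fact assms(1))

section \<open>Variational convexity and local support\<close>

definition local_support :: "('a::euclidean_space \<Rightarrow> ereal) \<Rightarrow> 'a \<Rightarrow> 'a \<Rightarrow> bool" where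
  "local_support f xb vb \<longleftrightarrow>
     (\<exists>U V \<epsilon>. open U \<and> xb \<in> U \<and> open V \<and> vb \<in> V \<and> \<epsilon> > 0 \<and>
        (\<forall>x v y. v \<in> limiting_subdiff f x \<longrightarrow> x \<in> sublevel_nbhd f xb U \<epsilon> \<longrightarrow> v \<in> V \<longrightarrow>
           y \<in> U \<longrightarrow> f x + ereal (v \<bullet> (y - x)) \<le> f y))"

section \<open>Subgradient inequalities for convex functions\<close>

text \<open>On the segment from \<open>x\<close> to \<open>y\<close> the regular subgradient bounds
  \<open>f\<close> below and convexity bounds it above; division by \<open>t\<close> makes the local
  inequality global.\<close>

lemma convex_fun_regular_subgradient_ineq:
  assumes "convex_fun f" "v \<in> regular_subdiff f x"
  shows "f x + ereal (v \<bullet> (y - x)) \<le> f y"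
proof (rule ereal_le_real)
  obtain a where a: "f x = ereal a" and
    H: "\<And>e. e > 0 \<Longrightarrow> \<forall>\<^sub>F y in nhds x. ereal (a + v \<bullet> (y - x) - e * norm (y - x)) \<le> f y"
    using assms(2) unfolding regular_subdiff_iff by blast
  \<comment> \<open>Testing only real upper bounds \<open>r\<close> of \<open>f y\<close> keeps the
    argument inside the epigraph and avoids a case split on infinite values of
    \<open>f y\<close>.\<close>
  fix r assume r: "f y \<le> ereal r"
  have "a + v \<bullet> (y - x) \<le> r + d" if "d > 0" for d
  proof -
    \<comment> \<open>The slope is chosen so that the error left after dividing by \<open>t\<close>
      is at most \<open>d\<close>; the \<open>+ 1\<close> covers \<open>y = x\<close>.\<close>
    define e where "e = d / (norm (y - x) + 1)"
    have "norm (y - x) + 1 > 0" by (simp add: add_nonneg_pos)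
    then have e: "e > 0" "e * norm (y - x) \<le> d"
      using that unfolding e_def by (auto simp: field_simps)
    have "((\<lambda>t. x + t *\<^sub>R (y - x)) \<longlongrightarrow> x + 0 *\<^sub>R (y - x)) (at_right 0)"
      by (intro tendsto_intros)
    then have "filterlim (\<lambda>t. x + t *\<^sub>R (y - x)) (nhds x) (at_right (0::real))" by simp
    from eventually_compose_filterlim[OF H[OF e(1)] this]
    have "\<forall>\<^sub>F t in at_right 0. ereal (a + t * (v \<bullet> (y - x)) - e * (\<bar>t\<bar> * norm (y - x)))
        \<le> f (x + t *\<^sub>R (y - x))" by simp
    moreover have "\<forall>\<^sub>F t in at_right (0::real). t < 1"
      by (metis eventually_at_right_real less_numeral_extra(1) eventually_mono greaterThanLessThan_iff)
    moreover have "\<forall>\<^sub>F t in at_right (0::real). t > 0" by (rule eventually_at_right_less)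
    ultimately have "\<forall>\<^sub>F t in at_right (0::real). 0 < t \<and> t < 1 \<and>
        ereal (a + t * (v \<bullet> (y - x)) - e * (\<bar>t\<bar> * norm (y - x))) \<le> f (x + t *\<^sub>R (y - x))"
      by eventually_elim auto
    then obtain t where t: "0 < t" "t < 1"
       "ereal (a + t * (v \<bullet> (y - x)) - e * (\<bar>t\<bar> * norm (y - x))) \<le> f (x + t *\<^sub>R (y - x))"
      using eventually_happens by force
    have "(1 - t) *\<^sub>R (x, a) + t *\<^sub>R (y, r) \<in> {(x, r). f x \<le> ereal r}"
      using assms(1) a r t unfolding convex_fun_def by (intro convexD) auto
    then have "f (x + t *\<^sub>R (y - x)) \<le> ereal ((1 - t) * a + t * r)"
      by (simp add: algebra_simps)
    with t(3) have "ereal (a + t * (v \<bullet> (y - x)) - e * (\<bar>t\<bar> * norm (y - x))) \<le> ereal ((1 - t) * a + t * r)"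
      by (rule order_trans)
    then have "t * (a + v \<bullet> (y - x) - e * norm (y - x)) \<le> t * r" using t by (simp add: algebra_simps)
    then have "a + v \<bullet> (y - x) - e * norm (y - x) \<le> r" using t(1) by simp
    then show ?thesis using e(2) by linarith
  qed
  then show "f x + ereal (v \<bullet> (y - x)) \<le> ereal r"
    unfolding a by (simp add: field_le_epsilon)
qed

lemma subgradient_ineq_limit:
  assumes "\<And>k. f (xs k) + ereal (vs k \<bullet> (y - xs k)) \<le> f y"
    "xs \<longlonglongrightarrow> x" "(\<lambda>k. f (xs k)) \<longlonglongrightarrow> f x" "vs \<longlonglongrightarrow> v" "\<bar>f x\<bar> \<noteq> \<infinity>"
  shows "f x + ereal (v \<bullet> (y - x)) \<le> f y"
proof -
  have "(\<lambda>k. f (xs k) + ereal (vs k \<bullet> (y - xs k))) \<longlonglongrightarrow> f x + ereal (v \<bullet> (y - x))"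
    using assms by (intro tendsto_add_ereal tendsto_intros) auto
  then show ?thesis by (rule LIMSEQ_le_const2) (use assms(1) in auto)
qed

lemma convex_fun_subgradient_ineq:
  assumes "convex_fun f" "v \<in> limiting_subdiff f x"
  shows "f x + ereal (v \<bullet> (y - x)) \<le> f y"
proof -
  obtain xs vs where 1: "\<And>k. vs k \<in> regular_subdiff f (xs k)"
      "xs \<longlonglongrightarrow> x" "(\<lambda>k. f (xs k)) \<longlonglongrightarrow> f x" "vs \<longlonglongrightarrow> v"
    using assms(2) unfolding limiting_subdiff_def mem_Collect_eq by metis
  show ?thesis
    by (rule subgradient_ineq_limit[OF convex_fun_regular_subgradient_ineq[OF assms(1) 1(1)] 1(2-4)
        limiting_subdiff_finite[OF assms(2)]])
qed

text \<open>On the common graph \<open>f\<close> and \<open>fh\<close> agree and \<open>v\<close> is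
  a subgradient of the convex \<open>fh\<close>; its global inequality passes to \<open>f\<close> on
  \<open>U\<close> because \<open>fh \<le> f\<close> there.\<close>

lemma variationally_convex_imp_local_support:
  assumes "variationally_convex f xb vb"
  shows "local_support f xb vb"
proof -
  obtain U V fh \<epsilon> where H: "open U" "xb \<in> U" "open V" "vb \<in> V" "convex_fun fh"
    "\<forall>x\<in>U. fh x \<le> f x" "\<epsilon> > 0"
    "(sublevel_nbhd f xb U \<epsilon> \<times> V) \<inter> gph_subdiff f = (U \<times> V) \<inter> gph_subdiff fh"
    "\<forall>(x, v) \<in> (U \<times> V) \<inter> gph_subdiff fh. f x = fh x"
    using assms unfolding variationally_convex_def by (elim conjE exE) (rule that; assumption)
  have "f x + ereal (v \<bullet> (y - x)) \<le> f y"
    if "v \<in> limiting_subdiff f x" "x \<in> sublevel_nbhd f xb U \<epsilon>" "v \<in> V" "y \<in> U" for x v y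
  proof -
    have "(x, v) \<in> (sublevel_nbhd f xb U \<epsilon> \<times> V) \<inter> gph_subdiff f"
      using that by (simp add: gph_subdiff_def)
    then have "(x, v) \<in> (U \<times> V) \<inter> gph_subdiff fh" using H(8) by simp
    then have "f x = fh x" "v \<in> limiting_subdiff fh x" using H(9) by (auto simp: gph_subdiff_def)
    then show ?thesis
      using convex_fun_subgradient_ineq[OF H(5), of v x y] H(6) that(4) by (metis order_trans)
  qed
  then show ?thesis unfolding local_support_def using H by blast
qed

section \<open>Converse: a convex minorant from affine supports\<close>

definition affine_envelope :: "('a::euclidean_space \<Rightarrow> ereal) \<Rightarrow> ('a \<times> 'a) set \<Rightarrow> 'a \<Rightarrow> ereal" where
  "affine_envelope f G y = (SUP (x, v)\<in>G. f x + ereal (v \<bullet> (y - x)))"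

lemma affine_envelope_le_iff:
  "affine_envelope f G y \<le> c \<longleftrightarrow> (\<forall>(x, v)\<in>G. f x + ereal (v \<bullet> (y - x)) \<le> c)"
  unfolding affine_envelope_def SUP_le_iff by (auto split: prod.splits)

lemma affine_envelope_ge:
  "(x, v) \<in> G \<Longrightarrow> f x + ereal (v \<bullet> (y - x)) \<le> affine_envelope f G y"
  using affine_envelope_le_iff[of f G y "affine_envelope f G y"] by auto

lemma convex_affine_envelope:
  assumes "\<And>x v. (x, v) \<in> G \<Longrightarrow> \<bar>f x\<bar> \<noteq> \<infinity>"
  shows "convex_fun (affine_envelope f G)"
  unfolding convex_fun_def
proof (rule convexI, clarsimp simp: affine_envelope_le_iff)
  fix y1 y2 x v and r1 r2 s t :: real
  assume st: "0 \<le> s" "0 \<le> t" "s + t = 1" and G: "(x, v) \<in> G"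
    and 1: "\<forall>(x, v)\<in>G. f x + ereal (v \<bullet> (y1 - x)) \<le> ereal r1"
    and 2: "\<forall>(x, v)\<in>G. f x + ereal (v \<bullet> (y2 - x)) \<le> ereal r2"
  obtain a where a: "f x = ereal a" using assms[OF G] by auto
  have "a + v \<bullet> (y1 - x) \<le> r1" "a + v \<bullet> (y2 - x) \<le> r2" using 1 2 G a by auto
  then have "s * (a + v \<bullet> (y1 - x)) + t * (a + v \<bullet> (y2 - x)) \<le> s * r1 + t * r2"
    using st by (intro add_mono mult_left_mono) auto
  moreover have "s * (a + v \<bullet> (y1 - x)) + t * (a + v \<bullet> (y2 - x)) =
      (s + t) * a + v \<bullet> (s *\<^sub>R y1 + t *\<^sub>R y2 - (s + t) *\<^sub>R x)"
    by (simp add: inner_diff_right inner_add_right algebra_simps)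
  ultimately show "f x + ereal (v \<bullet> (s *\<^sub>R y1 + t *\<^sub>R y2 - x)) \<le> ereal (s * r1 + t * r2)"
    using st a by simp
qed

text \<open>A single pair of \<open>G\<close> already beats \<open>c\<close> at \<open>y\<close>,
  and its affine function is continuous.\<close>

lemma lsc_affine_envelope:
  assumes "\<And>x v. (x, v) \<in> G \<Longrightarrow> \<bar>f x\<bar> \<noteq> \<infinity>"
  shows "lsc_fun (affine_envelope f G)"
  unfolding lsc_fun_iff
proof (intro allI impI)
  fix y c assume "c < affine_envelope f G y"
  then obtain x v where xv: "(x, v) \<in> G" "c < f x + ereal (v \<bullet> (y - x))"
    using affine_envelope_le_iff[of f G y c] by (auto simp: not_le[symmetric])
  have "((\<lambda>z. f x + ereal (v \<bullet> (z - x))) \<longlongrightarrow> f x + ereal (v \<bullet> (y - x))) (nhds y)"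
    using assms[OF xv(1)] by (intro tendsto_add_ereal tendsto_intros filterlim_ident) auto
  from order_tendstoD(1)[OF this xv(2)]
  show "\<forall>\<^sub>F z in nhds y. c < affine_envelope f G z"
    by eventually_elim (rule less_le_trans[OF _ affine_envelope_ge[OF xv(1)]])
qed

lemma global_subgradient_regular:
  assumes "f x = ereal a" "\<And>y. f x + ereal (v \<bullet> (y - x)) \<le> f y"
  shows "v \<in> regular_subdiff f x"
  by (rule regular_subdiff_proximal[where a=a and c=0]) (use assms in auto)

text \<open>A local form of Minty's argument: \<open>x\<close> minimises \<open>f y + norm (y - (x' + v'))^2 / 2\<close> over
  \<open>cball xb (5 * d)\<close>. The bounds place \<open>x\<close> in the interior of this ball, so \<open>v = x' + v' - x\<close> is a
  regular subgradient there.\<close>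

lemma local_support_resolvent:
  fixes f :: "'a::euclidean_space \<Rightarrow> ereal"
  assumes "lsc_fun f" "f xb = ereal b"
    and sup: "\<And>y. y \<in> U \<Longrightarrow> f xb + ereal (vb \<bullet> (y - xb)) \<le> f y"
    and d: "d > 0" "cball xb (5 * d) \<subseteq> U"
    and "dist x' xb < d" "dist v' vb < d"
  obtains x v where "v \<in> regular_subdiff f x" "x + v = x' + v'"
    "dist x xb \<le> 4 * d" "dist v vb \<le> 5 * d" "f x \<le> ereal (b + (norm vb + d) * (4 * d) + d\<^sup>2)"
proof -
  define z where "z = x' + v'"
  define h where "h y = f y + ereal (1 / 2 * (norm (y - z))\<^sup>2)" for y
  have "lsc_fun h" unfolding h_def by (intro lsc_fun_add_continuous assms(1) continuous_intros)
  moreover have "compact (cball xb (5 * d))" "cball xb (5 * d) \<noteq> {}" using d by auto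
  ultimately obtain x where x: "x \<in> cball xb (5 * d)" "\<And>y. y \<in> cball xb (5 * d) \<Longrightarrow> h x \<le> h y"
    using lsc_fun_attains_min by metis
  \<comment> \<open>The support inequality at \<open>xb\<close> bounds \<open>f x\<close> below and
    minimality against \<open>xb\<close> bounds it above; together they make \<open>f x\<close>
    finite and control the displacement of \<open>x\<close>.\<close>
  have low: "ereal (b + vb \<bullet> (x - xb)) \<le> f x" using sup[of x] x(1) d(2) assms(2) by auto
  have hb: "f x + ereal (1 / 2 * (norm (x - z))\<^sup>2) \<le> ereal (b + 1 / 2 * (norm (xb - z))\<^sup>2)"
    using x(2)[of xb] d(1) assms(2) unfolding h_def by simp
  obtain a where a: "f x = ereal a" using low hb by (cases "f x") auto
  have low: "b + vb \<bullet> (x - xb) \<le> a" using low a by simp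
  have hb: "a + 1 / 2 * (norm (x - z))\<^sup>2 \<le> b + 1 / 2 * (norm (xb - z))\<^sup>2" using hb a by simp
  have e1: "(norm (x - z))\<^sup>2 = (norm (x - x'))\<^sup>2 - 2 * (v' \<bullet> (x - x')) + (norm v')\<^sup>2"
    unfolding z_def power2_norm_eq_inner
    by (simp add: inner_diff_left inner_diff_right inner_add_left inner_add_right inner_commute)
  have e2: "(norm (xb - z))\<^sup>2 = (norm (xb - x'))\<^sup>2 - 2 * (v' \<bullet> (xb - x')) + (norm v')\<^sup>2"
    unfolding z_def power2_norm_eq_inner
    by (simp add: inner_diff_left inner_diff_right inner_add_left inner_add_right inner_commute)
  have e3: "v' \<bullet> (x - x') - v' \<bullet> (xb - x') = v' \<bullet> (x - xb)" by (simp add: inner_diff_right)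
  have up: "a + 1 / 2 * (norm (x - x'))\<^sup>2 \<le> b + v' \<bullet> (x - xb) + 1 / 2 * (norm (xb - x'))\<^sup>2"
    using hb e1 e2 e3 by argo
  have nx': "norm (xb - x') \<le> d" "norm (v' - vb) \<le> d"
    using assms(6,7) by (auto simp: dist_norm norm_minus_commute)
  then have sq: "(norm (xb - x'))\<^sup>2 \<le> d\<^sup>2" by (intro power_mono) auto
  \<comment> \<open>\<open>low\<close>, \<open>up\<close> and the Cauchy-Schwarz inequality give a
    quadratic inequality for \<open>t\<close>; completing the square yields
    \<open>t \<le> 3 * d\<close>. Then \<open>x\<close> is within \<open>4 * d\<close> of
    \<open>xb\<close> and the ball of radius \<open>d\<close> about \<open>x\<close> stays in the
    domain of minimisation.\<close>
  define t where "t = norm (x - x')"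
  have xxb: "norm (x - xb) \<le> t + d"
    using norm_triangle_ineq[of "x - x'" "x' - xb"] nx'(1) unfolding t_def
    by (simp add: norm_minus_commute)
  have "(v' - vb) \<bullet> (x - xb) \<le> d * norm (x - xb)"
    using norm_cauchy_schwarz[of "v' - vb" "x - xb"] nx'(2)
    by (meson mult_right_mono norm_ge_zero order_trans)
  also have "\<dots> \<le> d * (t + d)" using xxb d(1) by (intro mult_left_mono) auto
  finally have cs: "v' \<bullet> (x - xb) - vb \<bullet> (x - xb) \<le> d * t + d\<^sup>2"
    by (simp add: inner_diff_left distrib_left power2_eq_square)
  have "t\<^sup>2 \<le> 2 * d * t + 3 * d\<^sup>2"
    using up low sq cs unfolding t_def[symmetric] by (simp add: field_simps)
  then have "(t - d)\<^sup>2 \<le> (2 * d)\<^sup>2" by (simp add: power2_eq_square algebra_simps)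
  then have "t - d \<le> 2 * d" by (rule power2_le_imp_le) (use d(1) in simp)
  then have t3: "t \<le> 3 * d" by simp
  have xd: "norm (x - xb) \<le> 4 * d" using xxb t3 by linarith
  define v where "v = z - x"
  have "1 *\<^sub>R (z - x) \<in> regular_subdiff f x"
  proof (rule regular_subdiff_proximal_min[where f = f and k = 1 and p = z, OF a d(1)])
    fix y assume "dist y x < d"
    then have "dist xb y \<le> 5 * d"
      using xd dist_triangle[of xb y x] by (simp add: dist_norm norm_minus_commute)
    then show "f x + ereal (1 / 2 * (norm (x - z))\<^sup>2) \<le> f y + ereal (1 / 2 * (norm (y - z))\<^sup>2)"
      using x(2)[of y] unfolding h_def by simp
  qed
  then have "v \<in> regular_subdiff f x" by (simp add: v_def)
  moreover have "x + v = x' + v'" by (simp add: v_def z_def)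
  moreover have "dist x xb \<le> 4 * d" using xd by (simp add: dist_norm)
  moreover have "dist v vb \<le> 5 * d"
  proof -
    have "v - vb = (x' - x) + (v' - vb)" by (simp add: v_def z_def)
    then have "norm (v - vb) \<le> norm (x' - x) + norm (v' - vb)" by (metis norm_triangle_ineq)
    then show ?thesis using t3 nx'(2) d(1) unfolding t_def by (simp add: dist_norm norm_minus_commute)
  qed
  \<comment> \<open>The excess over \<open>b\<close> tends to zero with \<open>d\<close>; this later
    puts \<open>x\<close> into the attentive sublevel set.\<close>
  moreover have "f x \<le> ereal (b + (norm vb + d) * (4 * d) + d\<^sup>2)"
  proof -
    have "norm v' \<le> norm vb + d"
      using norm_triangle_ineq[of vb "v' - vb"] nx'(2) by simp
    then have "v' \<bullet> (x - xb) \<le> (norm vb + d) * (4 * d)"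
      using norm_cauchy_schwarz[of v' "x - xb"] xd d(1)
      by (meson mult_mono norm_ge_zero order_trans)
    moreover have "0 \<le> (norm (x - x'))\<^sup>2" "0 \<le> d\<^sup>2" by auto
    ultimately have "a \<le> b + (norm vb + d) * (4 * d) + d\<^sup>2" using up sq by linarith
    then show ?thesis using a by simp
  qed
  ultimately show thesis using that by blast
qed

text \<open>One inclusion of the graph equality comes from \<open>Geq\<close>. The other,
  \<open>mem_G\<close>, compares a pair of \<open>gph_subdiff fh\<close> with the resolvent pair of
  \<open>f\<close> that has the same sum.\<close>

lemma local_support_imp_variationally_convex:
  fixes f :: "'a::euclidean_space \<Rightarrow> ereal"
  assumes "proper_fun f" "lsc_fun f" "vb \<in> limiting_subdiff f xb" "local_support f xb vb"
  shows "variationally_convex f xb vb"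
proof -
  obtain U V \<epsilon> where H: "open U" "xb \<in> U" "open V" "vb \<in> V" "\<epsilon> > 0"
    and "\<forall>x v y. v \<in> limiting_subdiff f x \<longrightarrow> x \<in> sublevel_nbhd f xb U \<epsilon> \<longrightarrow> v \<in> V \<longrightarrow>
       y \<in> U \<longrightarrow> f x + ereal (v \<bullet> (y - x)) \<le> f y"
    using assms(4) unfolding local_support_def by (elim exE conjE) (rule that; assumption)
  note sup = this(6)[rule_format]
  obtain b where b: "f xb = ereal b" using limiting_subdiff_finite[OF assms(3)] by auto
  define G where "G = gph_subdiff f \<inter> (sublevel_nbhd f xb U \<epsilon> \<times> V)"
  define fh where "fh = affine_envelope f G"
  have G_iff: "(x, v) \<in> G \<longleftrightarrow> v \<in> limiting_subdiff f x \<and> x \<in> sublevel_nbhd f xb U \<epsilon> \<and> v \<in> V" for x v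
    unfolding G_def gph_subdiff_def by simp
  have Gfin: "\<bar>f x\<bar> \<noteq> \<infinity>" if "(x, v) \<in> G" for x v
    using that limiting_subdiff_finite[of v f x] unfolding G_iff by simp
  have conv: "convex_fun fh" and lsc: "lsc_fun fh"
    unfolding fh_def using convex_affine_envelope lsc_affine_envelope Gfin by blast+
  have le: "fh y \<le> f y" if "y \<in> U" for y
    unfolding fh_def affine_envelope_le_iff using sup[OF _ _ _ that] by (auto simp: G_iff)
  \<comment> \<open>The minorant of \<open>(x, v)\<close> takes the value \<open>f x\<close> at its
    own base point, so \<open>fh\<close> touches \<open>f\<close> there and \<open>v\<close> is a
    global subgradient of \<open>fh\<close>.\<close>
  have Geq: "fh x = f x" "v \<in> limiting_subdiff fh x" if xvG: "(x, v) \<in> G" for x v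
  proof -
    have "x \<in> U" using xvG unfolding G_iff sublevel_nbhd_def by simp
    moreover have "f x \<le> fh x" using affine_envelope_ge[OF xvG, of f x] unfolding fh_def
      by (simp flip: zero_ereal_def)
    ultimately show eq: "fh x = f x" using le by (simp add: order_antisym)
    obtain a where a: "f x = ereal a" using Gfin[OF xvG] by auto
    have "v \<in> regular_subdiff fh x"
    proof (rule global_subgradient_regular)
      show "fh x = ereal a" using eq a by simp
      show "fh x + ereal (v \<bullet> (y - x)) \<le> fh y" for y
        unfolding eq unfolding fh_def by (rule affine_envelope_ge[OF xvG])
    qed
    then show "v \<in> limiting_subdiff fh x"
      by (rule subsetD[OF regular_subset_limiting_subdiff])
  qed
  have xbG: "(xb, vb) \<in> G"
    using assms(3) H b unfolding G_iff sublevel_nbhd_def by simp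
  \<comment> \<open>Radius \<open>5 * d\<close> accommodates the output of the resolvent in both
    variables, and the last condition keeps its value below \<open>f xb + \<epsilon>\<close>. The
    final neighbourhoods are the balls of radius \<open>d\<close>.\<close>
  obtain d where d: "d > 0" "cball xb (5 * d) \<subseteq> U" "cball vb (5 * d) \<subseteq> V"
     "(norm vb + d) * (4 * d) + d\<^sup>2 < \<epsilon>"
  proof -
    obtain r1 r2 where r: "r1 > 0" "cball xb r1 \<subseteq> U" "r2 > 0" "cball vb r2 \<subseteq> V"
      using H open_contains_cball by metis
    have "((\<lambda>d. (norm vb + d) * (4 * d) + d\<^sup>2) \<longlongrightarrow> (norm vb + 0) * (4 * 0) + 0\<^sup>2) (at_right 0)"
      by (intro tendsto_intros)
    then have "\<forall>\<^sub>F d in at_right 0. (norm vb + d) * (4 * d) + d\<^sup>2 < \<epsilon>"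
      using H(5) by (intro order_tendstoD(2)) auto
    moreover have "\<forall>\<^sub>F d in at_right 0. d \<in> {0<..<r1 / 5}" "\<forall>\<^sub>F d in at_right 0. d \<in> {0<..<r2 / 5}"
      using r by (intro eventually_at_right_real; simp)+
    ultimately have "\<forall>\<^sub>F d in at_right 0. (norm vb + d) * (4 * d) + d\<^sup>2 < \<epsilon> \<and> d > 0 \<and> 5 * d \<le> r1 \<and> 5 * d \<le> r2"
      by eventually_elim auto
    then obtain d where "(norm vb + d) * (4 * d) + d\<^sup>2 < \<epsilon>" "d > 0" "5 * d \<le> r1" "5 * d \<le> r2"
      using eventually_happens by force
    then show thesis using that[of d] r by (meson order_trans subset_cball)
  qed
  have supb: "f xb + ereal (vb \<bullet> (y - xb)) \<le> f y" if "y \<in> U" for y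
    using sup[OF _ _ _ that] xbG unfolding G_iff by simp
  have mem_G: "(x', v') \<in> G"
    if near: "x' \<in> ball xb d" "v' \<in> ball vb d" and g: "v' \<in> limiting_subdiff fh x'" for x' v'
  proof -
    obtain x v where xv: "v \<in> regular_subdiff f x" "x + v = x' + v'"
      "dist x xb \<le> 4 * d" "dist v vb \<le> 5 * d" "f x \<le> ereal (b + (norm vb + d) * (4 * d) + d\<^sup>2)"
      by (rule local_support_resolvent[OF assms(2) b supb d(1,2), of x' v'])
         (use near in \<open>simp_all add: dist_commute\<close>)
    have "x \<in> U" "v \<in> V" using xv(3,4) d by (auto simp: dist_commute subset_iff)
    moreover have "f x < f xb + ereal \<epsilon>"
      using xv(5) d(4) b by (cases "f x") auto
    ultimately have xvG: "(x, v) \<in> G"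
      using subsetD[OF regular_subset_limiting_subdiff xv(1)] unfolding G_iff sublevel_nbhd_def by simp
    have "fh x + ereal (v \<bullet> (x' - x)) \<le> fh x'" "fh x' + ereal (v' \<bullet> (x - x')) \<le> fh x"
      using convex_fun_subgradient_ineq[OF conv] Geq(2)[OF xvG] g by auto
    moreover have "\<bar>fh x\<bar> \<noteq> \<infinity>" "\<bar>fh x'\<bar> \<noteq> \<infinity>"
      using limiting_subdiff_finite[OF Geq(2)[OF xvG]] limiting_subdiff_finite[OF g] by auto
    ultimately have "v \<bullet> (x' - x) + v' \<bullet> (x - x') \<le> 0"
      by (cases "fh x"; cases "fh x'") auto
    \<comment> \<open>Equal sums give \<open>v - v' = x' - x\<close>, so monotonicity forces the
      square of \<open>norm (x' - x)\<close> to be at most zero and the two pairs coincide.\<close>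
    moreover have "v = v' + (x' - x)" using xv(2) by (simp add: algebra_simps)
    ultimately have "(x' - x) \<bullet> (x' - x) \<le> 0"
      by (simp add: inner_add_left inner_diff_right)
    then have "x' = x" by (metis eq_iff_diff_eq_0 inner_gt_zero_iff not_less)
    then show ?thesis using xvG xv(2) by simp
  qed
  show ?thesis
    unfolding variationally_convex_def
  proof (intro conjI)
    show "xb \<in> eff_dom f" using b by (simp add: eff_dom_def)
    have sub: "ball xb d \<subseteq> U" "ball vb d \<subseteq> V"
      using d by (auto simp: subset_iff)
    have minorant: "\<forall>x\<in>ball xb d. fh x \<le> f x" using le sub by blast
    have "(x, v) \<in> (sublevel_nbhd f xb (ball xb d) \<epsilon> \<times> ball vb d) \<inter> gph_subdiff f \<longleftrightarrow>
        (x, v) \<in> (ball xb d \<times> ball vb d) \<inter> gph_subdiff fh" for x v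
    proof
      assume a: "(x, v) \<in> (sublevel_nbhd f xb (ball xb d) \<epsilon> \<times> ball vb d) \<inter> gph_subdiff f"
      then have "(x, v) \<in> G" using sub unfolding G_iff sublevel_nbhd_def gph_subdiff_def by auto
      then show "(x, v) \<in> (ball xb d \<times> ball vb d) \<inter> gph_subdiff fh"
        using Geq(2) a unfolding sublevel_nbhd_def gph_subdiff_def by auto
    next
      assume a: "(x, v) \<in> (ball xb d \<times> ball vb d) \<inter> gph_subdiff fh"
      then have "(x, v) \<in> G" using mem_G unfolding gph_subdiff_def by auto
      then show "(x, v) \<in> (sublevel_nbhd f xb (ball xb d) \<epsilon> \<times> ball vb d) \<inter> gph_subdiff f"
        using a unfolding G_iff sublevel_nbhd_def gph_subdiff_def by auto
    qed
    then have graph: "(sublevel_nbhd f xb (ball xb d) \<epsilon> \<times> ball vb d) \<inter> gph_subdiff f =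
        (ball xb d \<times> ball vb d) \<inter> gph_subdiff fh"
      by (intro set_eqI) (simp only: split_paired_all)
    have agree: "\<forall>(x, v) \<in> (ball xb d \<times> ball vb d) \<inter> gph_subdiff fh. f x = fh x"
      using mem_G Geq(1) unfolding gph_subdiff_def by fastforce
    show "\<exists>U V fh \<epsilon>.
        open U \<and> convex U \<and> xb \<in> U \<and> open V \<and> convex V \<and> vb \<in> V \<and>
        convex_fun fh \<and> lsc_fun fh \<and> (\<forall>x\<in>U. fh x \<le> f x) \<and> \<epsilon> > 0 \<and>
        (sublevel_nbhd f xb U \<epsilon> \<times> V) \<inter> gph_subdiff f = (U \<times> V) \<inter> gph_subdiff fh \<and>
        (\<forall>(x, v) \<in> (U \<times> V) \<inter> gph_subdiff fh. f x = fh x)"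
      by (rule exI[of _ "ball xb d"], rule exI[of _ "ball vb d"], rule exI[of _ fh],
          rule exI[of _ \<epsilon>], intro conjI minorant graph agree conv lsc H(5))
        (use d(1) in simp_all)
  qed (fact assms)+
qed

section \<open>Multipliers for compositions\<close>

abbreviation (input) adjoint_jacobian :: "(real ^ 'n \<Rightarrow> real ^ 'm) \<Rightarrow> real ^ 'n \<Rightarrow> real ^ 'm \<Rightarrow> real ^ 'n" where
  "adjoint_jacobian F x u \<equiv> transpose (jacobian F (at x)) *v u"

lemma C1_mapping_has_derivative:
  "C1_mapping F \<Longrightarrow> (F has_derivative (\<lambda>h. jacobian F (at x) *v h)) (at x)"
  unfolding C1_mapping_def using jacobian_works by blast

lemma C1_mapping_continuous: "C1_mapping F \<Longrightarrow> continuous_on UNIV F"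
  by (meson C1_mapping_has_derivative continuous_at_imp_continuous_on has_derivative_continuous)

lemma C1_mapping_tendsto: "C1_mapping F \<Longrightarrow> xs \<longlonglongrightarrow> x \<Longrightarrow> (\<lambda>k. F (xs k)) \<longlonglongrightarrow> F x"
  using continuous_on_UNIV_tendsto_nhds[OF C1_mapping_continuous] by (rule filterlim_compose)

lemma inner_adjoint_jacobian: "adjoint_jacobian F x u \<bullet> h = u \<bullet> (jacobian F (at x) *v h)"
  by (simp add: transpose_matrix_vector dot_lmul_matrix)

lemma tendsto_adjoint_jacobian:
  assumes "C1_mapping F" "xs \<longlonglongrightarrow> x" "us \<longlonglongrightarrow> u"
  shows "(\<lambda>k. adjoint_jacobian F (xs k) (us k)) \<longlonglongrightarrow> adjoint_jacobian F x u"
proof -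
  have "((\<lambda>x. jacobian F (at x)) \<longlongrightarrow> jacobian F (at x)) (nhds x)"
    using assms(1) unfolding C1_mapping_def by (intro continuous_on_UNIV_tendsto_nhds) auto
  from filterlim_compose[OF this assms(2)]
  have "(\<lambda>k. jacobian F (at (xs k))) \<longlonglongrightarrow> jacobian F (at x)" .
  then show ?thesis
    unfolding matrix_vector_mult_def transpose_def
    by (intro tendsto_vec_lambda tendsto_sum tendsto_mult) (auto intro!: tendsto_vec_nth assms(3))
qed

section \<open>First-order conditions and the approximate chain rule\<close>

text \<open>The limit is one-sided because the quotient inequalities below are derived for
  \<open>t > 0\<close> only.\<close>

lemma tendsto_directional_quotient:
  fixes p :: "'a::real_inner \<Rightarrow> real"
  assumes "(p has_derivative (\<lambda>h. w \<bullet> h)) (at x)"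
  shows "((\<lambda>t. (p (x + t *\<^sub>R h) - p x) / t) \<longlongrightarrow> w \<bullet> h) (at_right 0)"
proof -
  have "((\<lambda>t. x + t *\<^sub>R h) has_derivative (\<lambda>t. t *\<^sub>R h)) (at 0)"
    by (auto intro!: derivative_eq_intros)
  moreover have "(p has_derivative (\<lambda>h. w \<bullet> h)) (at (x + 0 *\<^sub>R h))" using assms by simp
  ultimately have "((\<lambda>t. p (x + t *\<^sub>R h)) has_derivative (\<lambda>t. w \<bullet> (t *\<^sub>R h))) (at 0)"
    by (rule has_derivative_compose)
  then have "((\<lambda>t. p (x + t *\<^sub>R h)) has_field_derivative (w \<bullet> h)) (at 0)"
    unfolding has_field_derivative_def by (simp add: mult_commute_abs)
  then have "((\<lambda>t. (p (x + t *\<^sub>R h) - p x) / t) \<longlongrightarrow> w \<bullet> h) (at 0)"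
    unfolding DERIV_def by simp
  then show ?thesis by (rule tendsto_within_subset) simp
qed

text \<open>For \<open>0 < t < 1\<close> convexity bounds the difference quotient by
  \<open>p y - p x\<close>, and the bound survives the limit.\<close>

lemma convex_on_gradient_ineq:
  fixes p :: "'a::real_inner \<Rightarrow> real"
  assumes "convex_on U p" "x \<in> U" "y \<in> U" "(p has_derivative (\<lambda>h. w \<bullet> h)) (at x)"
  shows "p x + w \<bullet> (y - x) \<le> p y"
proof -
  have "\<forall>\<^sub>F t in at_right (0::real). t \<in> {0<..<1}" by (rule eventually_at_right_real) simp
  then have "\<forall>\<^sub>F t in at_right 0. (p (x + t *\<^sub>R (y - x)) - p x) / t \<le> p y - p x"
  proof eventually_elim
    case (elim t)
    have "p ((1 - t) *\<^sub>R x + t *\<^sub>R y) \<le> (1 - t) * p x + t * p y"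
      using elim by (intro convex_onD[OF assms(1)] assms) auto
    moreover have "(1 - t) *\<^sub>R x + t *\<^sub>R y = x + t *\<^sub>R (y - x)" by (simp add: algebra_simps)
    ultimately have "p (x + t *\<^sub>R (y - x)) - p x \<le> t * (p y - p x)" by (simp add: algebra_simps)
    then show ?case using elim by (simp add: pos_divide_le_eq mult.commute)
  qed
  then have "w \<bullet> (y - x) \<le> p y - p x"
    by (intro tendsto_upperbound[OF tendsto_directional_quotient[OF assms(4)]]) auto
  then show ?thesis by simp
qed

text \<open>If \<open>x\<close> minimises \<open>p\<close> up to a cone of slope \<open>c\<close>, a
  step along \<open>- w\<close> shows that the descent rate, the square of \<open>norm w\<close>, is
  at most \<open>c * norm w\<close>.\<close>

lemma norm_gradient_le:
  fixes p :: "'a::real_inner \<Rightarrow> real"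
  assumes "(p has_derivative (\<lambda>h. w \<bullet> h)) (at x)" "0 \<le> c" "d > 0"
    and min: "\<And>y. dist y x < d \<Longrightarrow> p x \<le> p y + c * norm (y - x)"
  shows "norm w \<le> c"
proof -
  have "\<forall>\<^sub>F t in at_right (0::real). t \<in> {0<..<d / (norm w + 1)}"
    by (rule eventually_at_right_real) (use assms(3) in \<open>simp add: add_nonneg_pos\<close>)
  then have "\<forall>\<^sub>F t in at_right 0. - (c * norm w) \<le> (p (x + t *\<^sub>R (- w)) - p x) / t"
  proof eventually_elim
    case (elim t)
    then have "t * (norm w + 1) < d" by (simp add: pos_less_divide_eq add_nonneg_pos)
    then have "t * norm w < d" using elim by (simp add: distrib_left)
    then have "p x \<le> p (x + t *\<^sub>R (- w)) + c * (t * norm w)"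
      using min[of "x + t *\<^sub>R (- w)"] elim by (simp add: dist_norm)
    then show ?case using elim by (simp add: pos_le_divide_eq algebra_simps)
  qed
  then have "- (c * norm w) \<le> w \<bullet> (- w)"
    by (intro tendsto_lowerbound[OF tendsto_directional_quotient[OF assms(1)]]) auto
  then have "norm w * norm w \<le> c * norm w" by (simp add: power2_norm_eq_inner[symmetric] power2_eq_square)
  then show ?thesis using assms(2) by (cases "norm w = 0") auto
qed

text \<open>The quadratic penalty \<open>k / 2 * norm (y - F x')^2\<close> decouples \<open>g\<close> from \<open>F\<close>. As the penalised problems have
  minimisers \<open>(x\<^sub>k, y\<^sub>k)\<close> tending to \<open>(x, F x)\<close>, optimality in \<open>y\<close> makes \<open>k (F x\<^sub>k - y\<^sub>k)\<close> a regular
  subgradient of \<open>g\<close>, and optimality in \<open>x'\<close> makes its pullback almost equal to \<open>v\<close>.\<close>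

lemma fuzzy_chain_rule_regular:
  fixes g :: "real ^ 'm \<Rightarrow> ereal" and F :: "real ^ 'n \<Rightarrow> real ^ 'm"
  assumes g: "\<And>y. g y \<noteq> -\<infinity>" "lsc_fun g" and F: "C1_mapping F"
    and v: "v \<in> regular_subdiff (g \<circ> F) x" and e: "e > 0" and b: "g (F x) = ereal b"
  obtains x1 y1 u b1 where "u \<in> regular_subdiff g y1" "g y1 = ereal b1"
    "dist x1 x < e" "dist y1 (F x) < e" "dist b1 b < e" "dist (adjoint_jacobian F x1 u) v < e"
proof -
  \<comment> \<open>The penalised function carries slope \<open>2 * \<sigma>\<close>, which becomes
    the bound on the pullback error; \<open>e / 4\<close> makes it \<open>e / 2\<close>.\<close>
  define \<sigma> where "\<sigma> = e / 4"
  have \<sigma>: "\<sigma> > 0" using e by (simp add: \<sigma>_def)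
  have "\<forall>\<^sub>F y in nhds x. ereal (b + v \<bullet> (y - x) - \<sigma> * norm (y - x)) \<le> g (F y)"
    using v \<sigma> b unfolding regular_subdiff_iff by auto
  then obtain r where r: "r > 0"
    and low: "\<And>y. dist y x \<le> r \<Longrightarrow> ereal (b + v \<bullet> (y - x) - \<sigma> * norm (y - x)) \<le> g (F y)"
    unfolding eventually_nhds_metric_le by blast
  define K where "K = cball x r \<times> cball (F x) 1"
  have K: "compact K" "(x, F x) \<in> K" using r by (auto simp: K_def compact_Times)
  define q where "q n z = - (v \<bullet> (fst z - x)) + 2 * \<sigma> * norm (fst z - x)
      + real (Suc n) / 2 * (norm (snd z - F (fst z)))\<^sup>2" for n z
  define h where "h n z = (g \<circ> snd) z + ereal (q n z)" for n z
  have contF: "continuous_on UNIV (\<lambda>z :: (real ^ 'n) \<times> (real ^ 'm). F (fst z))"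
    by (rule continuous_on_compose2[OF C1_mapping_continuous[OF F]]) (auto intro: continuous_intros)
  have lsch: "lsc_fun (h n)" for n
    unfolding h_def q_def
    by (intro lsc_fun_add_continuous lsc_fun_compose g continuous_intros contF)
  have "\<exists>z\<in>K. \<forall>y\<in>K. h n z \<le> h n y" for n
    using lsc_fun_attains_min[OF lsch K(1)] K(2) by (metis empty_iff)
  then obtain z where z: "\<And>n. z n \<in> K" "\<And>n y. y \<in> K \<Longrightarrow> h n (z n) \<le> h n y" by metis
  have hx: "h n (x, F x) = ereal b" for n by (simp add: h_def q_def b)
  have hz: "g (snd (z n)) + ereal (q n (z n)) \<le> ereal b" for n
    using z(2)[OF K(2), of n] unfolding hx by (simp add: h_def)
  have "\<exists>c. g (snd (z n)) = ereal c" for n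
    using hz[of n] g(1)[of "snd (z n)"] by (cases "g (snd (z n))") auto
  then obtain c where c: "\<And>n. g (snd (z n)) = ereal (c n)" by metis
  have cq: "c n + q n (z n) \<le> b" for n using hz[of n] c[of n] by simp
  \<comment> \<open>A lower bound of \<open>g\<close> on the ball lets a fixed \<open>M\<close>
    control the penalty term, which forces \<open>snd l = F (fst l)\<close> in the limit.\<close>
  obtain m where m: "\<And>n. m \<le> c n"
  proof -
    obtain y0 where y0: "y0 \<in> cball (F x) 1" "\<And>y. y \<in> cball (F x) 1 \<Longrightarrow> g y0 \<le> g y"
      by (rule lsc_fun_attains_min[OF g(2), of "cball (F x) 1"]) auto
    obtain m where m: "g y0 = ereal m"
      using g(1)[of y0] y0(2)[of "F x"] b by (cases "g y0") auto
    have "m \<le> c n" for n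
      using y0(2)[of "snd (z n)"] z(1)[of n] m c[of n] unfolding K_def by (auto simp: mem_Times_iff)
    then show thesis by (rule that)
  qed
  define M where "M = b - m + norm v * r"
  have pen: "(norm (snd (z n) - F (fst (z n))))\<^sup>2 \<le> 2 * M * inverse (real (Suc n))" for n
  proof -
    have "v \<bullet> (fst (z n) - x) \<le> norm v * norm (fst (z n) - x)" by (rule norm_cauchy_schwarz)
    also have "\<dots> \<le> norm v * r"
      using z(1)[of n] by (intro mult_left_mono) (auto simp: K_def mem_Times_iff dist_norm norm_minus_commute)
    finally have "v \<bullet> (fst (z n) - x) \<le> norm v * r" .
    moreover have "0 \<le> 2 * \<sigma> * norm (fst (z n) - x)" using \<sigma> by simp
    ultimately have "real (Suc n) / 2 * (norm (snd (z n) - F (fst (z n))))\<^sup>2 \<le> M"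
      using cq[of n] m[of n] unfolding q_def M_def by linarith
    then show ?thesis by (simp add: field_simps)
  qed
  obtain l s where l: "l \<in> K" "strict_mono s" "(z \<circ> s) \<longlonglongrightarrow> l"
    using K(1) z(1) unfolding compact_def by blast
  define X Y where "X n = fst (z (s n))" and "Y n = snd (z (s n))" for n
  have X: "X \<longlonglongrightarrow> fst l" and Y: "Y \<longlonglongrightarrow> snd l"
    using tendsto_fst[OF l(3)] tendsto_snd[OF l(3)] unfolding X_def Y_def comp_def by auto
  have FX: "(\<lambda>n. F (X n)) \<longlonglongrightarrow> F (fst l)" by (rule C1_mapping_tendsto[OF F X])
  have "(\<lambda>n. (norm (Y n - F (X n)))\<^sup>2) \<longlonglongrightarrow> (norm (snd l - F (fst l)))\<^sup>2"
    by (intro tendsto_intros X Y FX)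
  moreover have "(\<lambda>n. 2 * M * inverse (real (Suc n))) \<longlonglongrightarrow> 2 * M * 0"
    by (intro tendsto_intros LIMSEQ_inverse_real_of_nat)
  then have "((\<lambda>n. 2 * M * inverse (real (Suc n))) \<circ> s) \<longlonglongrightarrow> 0"
    using LIMSEQ_subseq_LIMSEQ[OF _ l(2)] by fastforce
  ultimately have "(norm (snd l - F (fst l)))\<^sup>2 \<le> 0"
    by (rule LIMSEQ_le) (use pen in \<open>auto simp: X_def Y_def\<close>)
  then have l2: "snd l = F (fst l)" by simp
  have cle: "c (s n) \<le> b + v \<bullet> (X n - x) - 2 * \<sigma> * norm (X n - x)" for n
  proof -
    have "0 \<le> real (Suc (s n)) / 2 * (norm (snd (z (s n)) - F (fst (z (s n)))))\<^sup>2" by simp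
    then show ?thesis using cq[of "s n"] unfolding q_def X_def by linarith
  qed
  have "g (snd l) \<le> ereal (b + v \<bullet> (fst l - x) - 2 * \<sigma> * norm (fst l - x))"
  proof (rule lsc_fun_seq_le[OF g(2) Y])
    show "g (Y n) \<le> ereal (b + v \<bullet> (X n - x) - 2 * \<sigma> * norm (X n - x))" for n
      using cle[of n] c[of "s n"] by (simp add: Y_def)
    show "(\<lambda>n. ereal (b + v \<bullet> (X n - x) - 2 * \<sigma> * norm (X n - x)))
        \<longlonglongrightarrow> ereal (b + v \<bullet> (fst l - x) - 2 * \<sigma> * norm (fst l - x))"
      by (intro tendsto_intros X)
  qed
  moreover have "ereal (b + v \<bullet> (fst l - x) - \<sigma> * norm (fst l - x)) \<le> g (snd l)"
    unfolding l2 using l(1) by (intro low) (auto simp: K_def mem_Times_iff dist_commute)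
  ultimately have "ereal (b + v \<bullet> (fst l - x) - \<sigma> * norm (fst l - x))
      \<le> ereal (b + v \<bullet> (fst l - x) - 2 * \<sigma> * norm (fst l - x))"
    by (rule order_trans[rotated])
  \<comment> \<open>The value at the cluster point has a lower bound with slope
    \<open>\<sigma>\<close> and an upper bound with slope \<open>2 * \<sigma>\<close>, which is
    possible only at \<open>x\<close>.\<close>
  then have "\<sigma> * norm (fst l - x) \<le> 0" by simp
  then have l1: "fst l = x" using \<sigma> by (simp add: mult_le_0_iff)
  have "\<forall>\<^sub>F n in sequentially. dist (X n) x < min e r"
    using tendstoD[OF X, of "min e r"] e r l1 by simp
  moreover have "\<forall>\<^sub>F n in sequentially. dist (Y n) (F x) < min e 1"
    using tendstoD[OF Y, of "min e 1"] e l1 l2 by simp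
  moreover have "\<forall>\<^sub>F n in sequentially. b + v \<bullet> (X n - x) < b + e"
  proof (rule order_tendstoD(2))
    show "(\<lambda>n. b + v \<bullet> (X n - x)) \<longlonglongrightarrow> b + v \<bullet> (x - x)"
      using X unfolding l1 by (intro tendsto_intros)
  qed (use e in simp)
  moreover have "\<forall>\<^sub>F n in sequentially. ereal (b - e) < g (Y n)"
  proof -
    have "\<forall>\<^sub>F y in nhds (F x). ereal (b - e) < g y"
      using b e by (intro lsc_funD[OF g(2)]) simp
    moreover have "filterlim Y (nhds (F x)) sequentially" using Y l1 l2 by simp
    ultimately show ?thesis by (rule eventually_compose_filterlim)
  qed
  ultimately have "\<forall>\<^sub>F n in sequentially. dist (X n) x < min e r \<and> dist (Y n) (F x) < min e 1 \<and>
      b + v \<bullet> (X n - x) < b + e \<and> ereal (b - e) < g (Y n)"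
    by eventually_elim simp
  \<comment> \<open>One index places the minimiser in the interior of \<open>K\<close> in both
    variables and prepares the two bounds on the value of \<open>g\<close>.\<close>
  then obtain n where n: "dist (X n) x < e" "dist (X n) x < r" "dist (Y n) (F x) < e"
      "dist (Y n) (F x) < 1" "b + v \<bullet> (X n - x) < b + e" "ereal (b - e) < g (Y n)"
    using eventually_happens by force
  define k x1 y1 where "k = real (Suc (s n))" and "x1 = X n" and "y1 = Y n"
  have gy1: "g y1 = ereal (c (s n))" using c by (simp add: y1_def Y_def)
  have zs: "z (s n) = (x1, y1)" by (simp add: x1_def y1_def X_def Y_def)
  define u where "u = k *\<^sub>R (F x1 - y1)"
  have "u \<in> regular_subdiff g y1"
    unfolding u_def
  proof (rule regular_subdiff_proximal_min[where f = g and k = k and p = "F x1", OF gy1])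
    show "1 - dist y1 (F x) > 0" using n(4) by (simp add: y1_def)
    fix y assume "dist y y1 < 1 - dist y1 (F x)"
    then have "dist (F x) y \<le> 1" using dist_triangle[of "F x" y y1] by (simp add: dist_commute)
    then have "(x1, y) \<in> K" using n(2) by (auto simp: K_def x1_def dist_commute)
    from z(2)[OF this, of "s n"] have "h (s n) (x1, y1) \<le> h (s n) (x1, y)" unfolding zs .
    then show "g y1 + ereal (k / 2 * (norm (y1 - F x1))\<^sup>2) \<le> g y + ereal (k / 2 * (norm (y - F x1))\<^sup>2)"
      unfolding h_def q_def gy1 comp_def fst_conv snd_conv k_def by (cases "g y") auto
  qed
  \<comment> \<open>With \<open>y1\<close> fixed, the norm term of \<open>q\<close> may have a kink
    at \<open>x1\<close>, so it is left out of \<open>p\<close> and returns as the slope in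
    \<open>norm_gradient_le\<close>.\<close>
  moreover have "norm (adjoint_jacobian F x1 u - v) \<le> 2 * \<sigma>"
  proof (rule norm_gradient_le)
    define p where "p x' = - (v \<bullet> (x' - x)) + k / 2 * ((y1 - F x') \<bullet> (y1 - F x'))" for x'
    have "(p has_derivative (\<lambda>h. - (v \<bullet> (h - 0)) + k / 2 * ((y1 - F x1) \<bullet> (0 - jacobian F (at x1) *v h) +
        (0 - jacobian F (at x1) *v h) \<bullet> (y1 - F x1)))) (at x1)"
      unfolding p_def by (intro derivative_intros C1_mapping_has_derivative[OF F])
    moreover have "- (v \<bullet> (h - 0)) + k / 2 * ((y1 - F x1) \<bullet> (0 - jacobian F (at x1) *v h) +
        (0 - jacobian F (at x1) *v h) \<bullet> (y1 - F x1)) = (adjoint_jacobian F x1 u - v) \<bullet> h" for h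
      unfolding inner_commute[of "0 - jacobian F (at x1) *v h"]
      by (simp add: inner_diff_left inner_adjoint_jacobian u_def right_diff_distrib
          del: transpose_matrix_vector)
    ultimately show "(p has_derivative (\<lambda>h. (adjoint_jacobian F x1 u - v) \<bullet> h)) (at x1)" by simp
    show "r - dist x1 x > 0" using n(2) by (simp add: x1_def)
    fix x' assume "dist x' x1 < r - dist x1 x"
    then have "dist x x' \<le> r" using dist_triangle[of x x' x1] by (simp add: dist_commute)
    then have "(x', y1) \<in> K" using n(4) by (auto simp: K_def y1_def dist_commute)
    from z(2)[OF this, of "s n"] have "h (s n) (x1, y1) \<le> h (s n) (x', y1)" unfolding zs .
    then have "p x1 + 2 * \<sigma> * norm (x1 - x) \<le> p x' + 2 * \<sigma> * norm (x' - x)"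
      unfolding h_def q_def comp_def fst_conv snd_conv gy1 p_def k_def
      by (simp add: power2_norm_eq_inner algebra_simps)
    moreover have "2 * \<sigma> * norm (x' - x) \<le> 2 * \<sigma> * (norm (x' - x1) + norm (x1 - x))"
      using \<sigma> norm_triangle_ineq[of "x' - x1" "x1 - x"] by (intro mult_left_mono) auto
    ultimately show "p x1 \<le> p x' + 2 * \<sigma> * norm (x' - x1)" by (simp add: distrib_left)
  qed (use \<sigma> in simp)
  moreover have "dist (c (s n)) b < e"
  proof -
    have "0 \<le> 2 * \<sigma> * norm (X n - x)" using \<sigma> by simp
    then have "c (s n) < b + e" using cle[of n] n(5) by linarith
    moreover have "b - e < c (s n)" using n(6) gy1 by (simp add: y1_def)
    ultimately show ?thesis by (simp add: dist_real_def abs_less_iff)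
  qed
  ultimately show thesis
    using that[of u y1 "c (s n)" x1] gy1 n e by (simp add: x1_def y1_def \<sigma>_def dist_norm)
qed

text \<open>A regular subgradient at a nearby \<open>x'\<close> reduces this to
  \<open>fuzzy_chain_rule_regular\<close> at scale \<open>e / 2\<close>; the continuity radius
  \<open>d\<close> keeps \<open>F x'\<close> within \<open>e / 2\<close> of
  \<open>F x\<close>.\<close>

lemma fuzzy_chain_rule:
  fixes g :: "real ^ 'm \<Rightarrow> ereal" and F :: "real ^ 'n \<Rightarrow> real ^ 'm"
  assumes g: "\<And>y. g y \<noteq> -\<infinity>" "lsc_fun g" and F: "C1_mapping F"
    and v: "v \<in> limiting_subdiff (g \<circ> F) x" and e: "e > 0" and b: "g (F x) = ereal b"
  obtains x1 y1 u b1 where "u \<in> regular_subdiff g y1" "g y1 = ereal b1"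
    "dist x1 x < e" "dist y1 (F x) < e" "dist b1 b < e" "dist (adjoint_jacobian F x1 u) v < e"
proof -
  have "\<forall>\<^sub>F x' in nhds x. dist (F x') (F x) < e / 2"
    using continuous_on_UNIV_tendsto_nhds[OF C1_mapping_continuous[OF F]] e by (intro tendstoD) auto
  then obtain d where d: "d > 0" "\<And>x'. dist x' x < d \<Longrightarrow> dist (F x') (F x) < e / 2"
    unfolding eventually_nhds_metric by blast
  obtain a where "(g \<circ> F) x = ereal a" and approx: "\<forall>e>0. \<exists>x' v' a'. v' \<in> regular_subdiff (g \<circ> F) x' \<and>
      (g \<circ> F) x' = ereal a' \<and> dist x' x < e \<and> dist a' a < e \<and> dist v' v < e"
    using v unfolding limiting_subdiff_iff by (elim exE conjE) (rule that; assumption)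
  then have "a = b" using b by simp
  then obtain x' v' a' where 1: "v' \<in> regular_subdiff (g \<circ> F) x'" "(g \<circ> F) x' = ereal a'"
      "dist x' x < min d (e / 2)" "dist a' b < min d (e / 2)" "dist v' v < min d (e / 2)"
    using approx[rule_format, of "min d (e / 2)"] d(1) e by force
  obtain x1 y1 u b1 where 2: "u \<in> regular_subdiff g y1" "g y1 = ereal b1"
    "dist x1 x' < e / 2" "dist y1 (F x') < e / 2" "dist b1 a' < e / 2" "dist (adjoint_jacobian F x1 u) v' < e / 2"
    by (rule fuzzy_chain_rule_regular[OF g F 1(1), of "e / 2" a']) (use 1(2) e in simp_all)
  have "dist x1 x < e" "dist b1 b < e" "dist (adjoint_jacobian F x1 u) v < e"
    using 1 2 dist_triangle[of x1 x x'] dist_triangle[of b1 b a'] dist_triangle[of "adjoint_jacobian F x1 u" v v']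
    by auto
  moreover have "dist y1 (F x) < e"
    using 2(4) d(2)[of x'] 1(3) dist_triangle[of y1 "F x" "F x'"] by auto
  ultimately show thesis using that 2 by blast
qed

section \<open>Bounded multipliers from the constraint qualification\<close>

text \<open>Unbounded multipliers, once normalised, cluster at a unit horizon subgradient whose
  pullback vanishes, against \<open>cq\<close>. \<open>x\<close> and \<open>y\<close> vary
  independently because the approximate chain rule delivers separate base points for
  \<open>F\<close> and \<open>g\<close>.\<close>

lemma multipliers_locally_bounded:
  fixes g :: "real ^ 'm \<Rightarrow> ereal" and F :: "real ^ 'n \<Rightarrow> real ^ 'm"
  assumes F: "C1_mapping F" and b: "g (F xb) = ereal b"
    and cq: "\<And>w. w \<in> horizon_subdiff g (F xb) \<Longrightarrow> adjoint_jacobian F xb w = 0 \<Longrightarrow> w = 0"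
  obtains d M where "d > 0"
    "\<forall>x y u a. u \<in> regular_subdiff g y \<longrightarrow> g y = ereal a \<longrightarrow> dist x xb < d \<longrightarrow> dist y (F xb) < d \<longrightarrow>
       dist a b < d \<longrightarrow> norm (adjoint_jacobian F x u) \<le> C \<longrightarrow> norm u \<le> M"
proof (rule ccontr)
  assume neg: "\<not> thesis"
  have "\<exists>x y u a. u \<in> regular_subdiff g y \<and> g y = ereal a \<and> dist x xb < inverse (real (Suc k)) \<and>
      dist y (F xb) < inverse (real (Suc k)) \<and> dist a b < inverse (real (Suc k)) \<and>
      norm (adjoint_jacobian F x u) \<le> C \<and> \<not> norm u \<le> real (Suc k)" for k
    using neg that[of "inverse (real (Suc k))" "real (Suc k)"] positive_imp_inverse_positive[of "real (Suc k)"]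
    by fastforce
  then obtain xs ys us a where
    us: "\<And>k. us k \<in> regular_subdiff g (ys k)" and a: "\<And>k. g (ys k) = ereal (a k)"
    and xs: "\<And>k. dist (xs k) xb < inverse (real (Suc k))"
    and ys: "\<And>k. dist (ys k) (F xb) < inverse (real (Suc k))"
    and ab: "\<And>k. dist (a k) b < inverse (real (Suc k))"
    and C: "\<And>k. norm (adjoint_jacobian F (xs k) (us k)) \<le> C"
    and big: "\<And>k. real (Suc k) < norm (us k)" unfolding not_le by metis
  have lim: "xs \<longlonglongrightarrow> xb" "ys \<longlonglongrightarrow> F xb" "a \<longlonglongrightarrow> b"
    using tendsto_inverse_Suc_dist[OF xs tendsto_const] tendsto_inverse_Suc_dist[OF ys tendsto_const]
      tendsto_inverse_Suc_dist[OF ab tendsto_const] by auto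
  \<comment> \<open>The inverse norms serve as the vanishing scalars in
    \<open>horizon_subdiff\<close>.\<close>
  define l where "l k = inverse (norm (us k))" for k
  have pos: "norm (us k) > 0" for k by (rule less_trans[OF _ big]) simp
  then have lpos: "l k > 0" for k by (simp add: l_def)
  have "l k < inverse (real (Suc k))" for k unfolding l_def by (rule less_imp_inverse_less[OF big]) simp
  then have l0: "l \<longlonglongrightarrow> 0"
    by (intro tendsto_inverse_Suc_dist[of l "\<lambda>_. 0"]) (use lpos in \<open>auto simp: dist_real_def less_imp_le\<close>)
  have "l k *\<^sub>R us k \<in> sphere 0 1" for k using pos[of k] by (simp add: l_def)
  then have "\<forall>k. l k *\<^sub>R us k \<in> sphere 0 1" ..
  then obtain w s where w: "w \<in> sphere 0 1" "strict_mono s" "((\<lambda>k. l k *\<^sub>R us k) \<circ> s) \<longlonglongrightarrow> w"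
    by (rule seq_compactE[OF compact_imp_seq_compact[OF compact_sphere]])
  have lim': "(xs \<circ> s) \<longlonglongrightarrow> xb" "(ys \<circ> s) \<longlonglongrightarrow> F xb" "(a \<circ> s) \<longlonglongrightarrow> b" "(l \<circ> s) \<longlonglongrightarrow> 0"
    using LIMSEQ_subseq_LIMSEQ[OF _ w(2)] lim l0 by blast+
  have "w \<in> horizon_subdiff g (F xb)"
    unfolding horizon_subdiff_def mem_Collect_eq
  proof (intro conjI exI allI)
    show "(l \<circ> s) k > 0" for k using lpos by simp
    show "(us \<circ> s) k \<in> regular_subdiff g ((ys \<circ> s) k)" for k using us by simp
    show "(\<lambda>k. g ((ys \<circ> s) k)) \<longlonglongrightarrow> g (F xb)" using lim'(3) a b by (simp add: comp_def)
    show "(\<lambda>k. (l \<circ> s) k *\<^sub>R (us \<circ> s) k) \<longlonglongrightarrow> w" using w(3) by (simp add: comp_def)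
  qed (use lim' b in \<open>simp_all add: comp_def\<close>)
  \<comment> \<open>The pullbacks are bounded by \<open>C\<close>, so after scaling their norms are
    at most \<open>l k * C\<close> and vanish in the limit.\<close>
  moreover have "adjoint_jacobian F xb w = 0"
  proof (rule LIMSEQ_unique)
    show "(\<lambda>k. adjoint_jacobian F ((xs \<circ> s) k) (((\<lambda>k. l k *\<^sub>R us k) \<circ> s) k)) \<longlonglongrightarrow> adjoint_jacobian F xb w"
      by (rule tendsto_adjoint_jacobian[OF F lim'(1) w(3)])
    have eq: "adjoint_jacobian F ((xs \<circ> s) k) (((\<lambda>k. l k *\<^sub>R us k) \<circ> s) k) =
        (l \<circ> s) k *\<^sub>R adjoint_jacobian F (xs (s k)) (us (s k))" for k
      by (simp add: matrix_vector_mult_scaleR)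
    have "(\<lambda>k. (l \<circ> s) k * C) \<longlonglongrightarrow> 0 * C" by (intro tendsto_intros lim')
    then have "(\<lambda>k. (l \<circ> s) k * C) \<longlonglongrightarrow> 0" by simp
    then show "(\<lambda>k. adjoint_jacobian F ((xs \<circ> s) k) (((\<lambda>k. l k *\<^sub>R us k) \<circ> s) k)) \<longlonglongrightarrow> 0"
      unfolding eq
      by (rule Lim_null_comparison[rotated])
         (auto intro!: always_eventually mult_left_mono C[simplified] simp: less_imp_le[OF lpos] abs_of_pos[OF lpos])
  qed
  ultimately have "w = 0" by (rule cq)
  with w(1) show False by simp
qed

text \<open>A bound on the approximate multipliers lets them cluster, which upgrades the approximate
  rule to an exact one. Retaining \<open>M\<close> in the conclusion gives bounds that are uniform
  along a sequence of base points.\<close>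

lemma chain_rule_bounded:
  fixes g :: "real ^ 'm \<Rightarrow> ereal" and F :: "real ^ 'n \<Rightarrow> real ^ 'm"
  assumes g: "\<And>y. g y \<noteq> -\<infinity>" "lsc_fun g" and F: "C1_mapping F"
    and b: "g (F x) = ereal b" and v: "v \<in> limiting_subdiff (g \<circ> F) x" and d: "d > 0"
    and bdd: "\<And>x' y u a. u \<in> regular_subdiff g y \<Longrightarrow> g y = ereal a \<Longrightarrow> dist x' x < d \<Longrightarrow>
       dist y (F x) < d \<Longrightarrow> dist a b < d \<Longrightarrow> norm (adjoint_jacobian F x' u) \<le> norm v + 1 \<Longrightarrow> norm u \<le> M"
  obtains u where "u \<in> limiting_subdiff g (F x)" "v = adjoint_jacobian F x u" "norm u \<le> M"
proof -
  \<comment> \<open>The three scales serve different ends: \<open>d\<close> makes \<open>bdd\<close>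
    applicable, \<open>1\<close> gives the bound \<open>norm v + 1\<close>, and the inverse makes
    the sequences converge.\<close>
  have "\<exists>x1 y1 u b1. u \<in> regular_subdiff g y1 \<and> g y1 = ereal b1 \<and>
      dist x1 x < min (min d 1) (inverse (real (Suc k))) \<and> dist y1 (F x) < min (min d 1) (inverse (real (Suc k))) \<and>
      dist b1 b < min (min d 1) (inverse (real (Suc k))) \<and>
      dist (adjoint_jacobian F x1 u) v < min (min d 1) (inverse (real (Suc k)))" for k
    by (rule fuzzy_chain_rule[OF g F v _ b, of "min (min d 1) (inverse (real (Suc k)))"])
       (use d in simp, blast)
  then obtain xs ys us a where us: "\<And>k. us k \<in> regular_subdiff g (ys k)" and a: "\<And>k. g (ys k) = ereal (a k)"
    and xs: "\<And>k. dist (xs k) x < min (min d 1) (inverse (real (Suc k)))"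
    and ys: "\<And>k. dist (ys k) (F x) < min (min d 1) (inverse (real (Suc k)))"
    and ab: "\<And>k. dist (a k) b < min (min d 1) (inverse (real (Suc k)))"
    and vs: "\<And>k. dist (adjoint_jacobian F (xs k) (us k)) v < min (min d 1) (inverse (real (Suc k)))"
    by metis
  have lim: "xs \<longlonglongrightarrow> x" "ys \<longlonglongrightarrow> F x" "a \<longlonglongrightarrow> b" "(\<lambda>k. adjoint_jacobian F (xs k) (us k)) \<longlonglongrightarrow> v"
    by (rule tendsto_inverse_Suc_dist[OF _ tendsto_const], use xs ys ab vs in simp)+
  have "norm (us k) \<le> M" for k
  proof (rule bdd[OF us a])
    have "norm (adjoint_jacobian F (xs k) (us k)) \<le> norm v + norm (adjoint_jacobian F (xs k) (us k) - v)"
      by (rule norm_triangle_sub)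
    also have "\<dots> \<le> norm v + 1" using vs[of k] by (simp add: dist_norm)
    finally show "norm (adjoint_jacobian F (xs k) (us k)) \<le> norm v + 1" .
  qed (use xs[of k] ys[of k] ab[of k] in simp_all)
  then have "\<forall>k. us k \<in> cball 0 M" by simp
  then obtain u s where u: "u \<in> cball 0 M" "strict_mono s" "(us \<circ> s) \<longlonglongrightarrow> u"
    by (rule seq_compactE[OF compact_imp_seq_compact[OF compact_cball]])
  have lim': "(xs \<circ> s) \<longlonglongrightarrow> x" "(ys \<circ> s) \<longlonglongrightarrow> F x" "(a \<circ> s) \<longlonglongrightarrow> b"
    "((\<lambda>k. adjoint_jacobian F (xs k) (us k)) \<circ> s) \<longlonglongrightarrow> v"
    using LIMSEQ_subseq_LIMSEQ[OF _ u(2)] lim by blast+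
  have "u \<in> limiting_subdiff g (F x)"
  proof (rule limiting_subdiff_closed[OF _ lim'(2) _ u(3)])
    show "(us \<circ> s) k \<in> limiting_subdiff g ((ys \<circ> s) k)" for k
      using subsetD[OF regular_subset_limiting_subdiff us] by simp
    show "(\<lambda>k. g ((ys \<circ> s) k)) \<longlonglongrightarrow> g (F x)" using lim'(3) a b by (simp add: comp_def)
  qed (use b in simp)
  moreover have "v = adjoint_jacobian F x u"
    using LIMSEQ_unique[OF lim'(4)] tendsto_adjoint_jacobian[OF F lim'(1) u(3)] by (simp add: comp_def)
  ultimately show thesis using that u(1) by simp
qed

section \<open>Transfer of the support inequality to the composition\<close>

text \<open>Lower semicontinuity controls the values from below, the shrinking sublevel margin from
  above. Thus membership in ever smaller sublevel neighbourhoods gives \<open>f\<close>-attentive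
  convergence.\<close>

lemma tendsto_of_lsc_upper_bound:
  assumes "lsc_fun f" "xs \<longlonglongrightarrow> x" "f x = ereal b" "\<And>k. f (xs k) = ereal (a k)"
    "\<And>k. a k < b + inverse (real (Suc k))"
  shows "a \<longlonglongrightarrow> b"
proof (rule order_tendstoI)
  fix c assume "c < b"
  then have "\<forall>\<^sub>F y in nhds x. ereal c < f y" using assms(3) by (intro lsc_funD[OF assms(1)]) simp
  from eventually_compose_filterlim[OF this assms(2)]
  show "\<forall>\<^sub>F k in sequentially. c < a k" by (simp add: assms(4))
next
  fix c assume "b < c"
  have "(\<lambda>k. b + inverse (real (Suc k))) \<longlonglongrightarrow> b + 0"
    by (intro tendsto_intros LIMSEQ_inverse_real_of_nat)
  then have "\<forall>\<^sub>F k in sequentially. b + inverse (real (Suc k)) < c"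
    using \<open>b < c\<close> by (intro order_tendstoD(2)) auto
  then show "\<forall>\<^sub>F k in sequentially. a k < c"
    by eventually_elim (rule less_trans[OF assms(5)])
qed

lemma local_support_compose:
  fixes g :: "real ^ 'm \<Rightarrow> ereal" and F :: "real ^ 'n \<Rightarrow> real ^ 'm"
  assumes g: "\<And>y. g y \<noteq> -\<infinity>" "lsc_fun g" and F: "C1_mapping F"
    and b: "g (F xb) = ereal b"
    and supp: "\<And>ub. ub \<in> limiting_subdiff g (F xb) \<Longrightarrow> vb = adjoint_jacobian F xb ub \<Longrightarrow>
       local_support g (F xb) ub"
    and cq: "\<And>w. w \<in> horizon_subdiff g (F xb) \<Longrightarrow> adjoint_jacobian F xb w = 0 \<Longrightarrow> w = 0"
    and U: "open U" "xb \<in> U" and V: "open V" "vb \<in> V" and \<epsilon>: "\<epsilon> > 0"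
    and conv: "\<And>x u. x \<in> sublevel_nbhd (g \<circ> F) xb U \<epsilon> \<Longrightarrow> adjoint_jacobian F x u \<in> V \<Longrightarrow>
       adjoint_jacobian F x u \<in> limiting_subdiff (g \<circ> F) x \<Longrightarrow>
       u \<in> limiting_subdiff g (F x) \<Longrightarrow> convex_on U (\<lambda>y. u \<bullet> F y)"
  shows "local_support (g \<circ> F) xb vb"
proof (rule ccontr)
  assume neg: "\<not> local_support (g \<circ> F) xb vb"
  \<comment> \<open>Failure is tested on balls of radius \<open>1 / (k + 1)\<close> with the same
    sublevel margin, giving one violating triple per \<open>k\<close>.\<close>
  have "\<exists>x v y. v \<in> limiting_subdiff (g \<circ> F) x \<and>
      x \<in> sublevel_nbhd (g \<circ> F) xb (ball xb (inverse (real (Suc k)))) (inverse (real (Suc k))) \<and>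
      v \<in> ball vb (inverse (real (Suc k))) \<and> y \<in> ball xb (inverse (real (Suc k))) \<and>
      \<not> (g \<circ> F) x + ereal (v \<bullet> (y - x)) \<le> (g \<circ> F) y" for k
  proof (rule ccontr)
    assume none: "\<not> ?thesis"
    have "local_support (g \<circ> F) xb vb"
      unfolding local_support_def
      by (rule exI[of _ "ball xb (inverse (real (Suc k)))"], rule exI[of _ "ball vb (inverse (real (Suc k)))"],
          rule exI[of _ "inverse (real (Suc k))"], intro conjI)
        (use none in \<open>blast | simp\<close>)+
    with neg show False ..
  qed
  then obtain xs vs zs where vs: "\<And>k. vs k \<in> limiting_subdiff (g \<circ> F) (xs k)"
    and sub: "\<And>k. xs k \<in> sublevel_nbhd (g \<circ> F) xb (ball xb (inverse (real (Suc k)))) (inverse (real (Suc k)))"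
    and vb: "\<And>k. vs k \<in> ball vb (inverse (real (Suc k)))"
    and zb: "\<And>k. zs k \<in> ball xb (inverse (real (Suc k)))"
    and bad: "\<And>k. \<not> (g \<circ> F) (xs k) + ereal (vs k \<bullet> (zs k - xs k)) \<le> (g \<circ> F) (zs k)"
    by metis
  have lim: "xs \<longlonglongrightarrow> xb" "vs \<longlonglongrightarrow> vb" "zs \<longlonglongrightarrow> xb"
    by (rule tendsto_inverse_Suc_dist[OF _ tendsto_const],
        use sub vb zb in \<open>simp add: dist_commute sublevel_nbhd_def\<close>)+
  have Fx: "(\<lambda>k. F (xs k)) \<longlonglongrightarrow> F xb" and Fz: "(\<lambda>k. F (zs k)) \<longlonglongrightarrow> F xb"
    using lim C1_mapping_tendsto[OF F] by auto
  have "\<exists>a. g (F (xs k)) = ereal a" for k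
    using limiting_subdiff_finite[OF vs[of k]] by auto
  then obtain a where a: "\<And>k. g (F (xs k)) = ereal (a k)" by metis
  have alim: "a \<longlonglongrightarrow> b"
  proof (rule tendsto_of_lsc_upper_bound[OF g(2) Fx b a])
    show "a k < b + inverse (real (Suc k))" for k
      using sub[of k] b a[of k] by (simp add: sublevel_nbhd_def)
  qed
  \<comment> \<open>In \<open>norm vb + 2\<close>, one unit covers the distance of
    \<open>vs k\<close> from \<open>vb\<close> and the other the tolerance in
    \<open>chain_rule_bounded\<close>.\<close>
  obtain d M where d: "d > 0" and
    "\<forall>x y u a. u \<in> regular_subdiff g y \<longrightarrow> g y = ereal a \<longrightarrow> dist x xb < d \<longrightarrow> dist y (F xb) < d \<longrightarrow>
       dist a b < d \<longrightarrow> norm (adjoint_jacobian F x u) \<le> norm vb + 2 \<longrightarrow> norm u \<le> M"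
    by (rule multipliers_locally_bounded[where g = g and F = F and xb = xb and b = b and C = "norm vb + 2",
        OF F b cq])
  note bdd = this(2)[rule_format]
  \<comment> \<open>Halving \<open>d\<close> keeps the \<open>d / 2\<close> neighbourhoods of all
    late base points inside the region where \<open>M\<close> is valid.\<close>
  have d2: "d / 2 > 0" using d by simp
  have "\<forall>\<^sub>F k in sequentially. dist (xs k) xb < d / 2 \<and> dist (F (xs k)) (F xb) < d / 2 \<and>
      dist (a k) b < d / 2 \<and> dist (vs k) vb < 1"
    using tendstoD[OF lim(1) d2] tendstoD[OF Fx d2] tendstoD[OF alim d2] tendstoD[OF lim(2) zero_less_one]
    by eventually_elim simp
  then obtain N where N: "\<And>k. k \<ge> N \<Longrightarrow> dist (xs k) xb < d / 2 \<and> dist (F (xs k)) (F xb) < d / 2 \<and>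
      dist (a k) b < d / 2 \<and> dist (vs k) vb < 1"
    unfolding eventually_sequentially by blast
  have "\<exists>u. u \<in> limiting_subdiff g (F (xs (k + N))) \<and> vs (k + N) = adjoint_jacobian F (xs (k + N)) u \<and>
      norm u \<le> M" for k
  proof (rule chain_rule_bounded[OF g F a vs d2, of "k + N" M])
    note near = N[of "k + N", simplified]
    fix x' y u a' assume 1: "u \<in> regular_subdiff g y" "g y = ereal a'" "dist x' (xs (k + N)) < d / 2"
      "dist y (F (xs (k + N))) < d / 2" "dist a' (a (k + N)) < d / 2"
      "norm (adjoint_jacobian F x' u) \<le> norm (vs (k + N)) + 1"
    show "norm u \<le> M"
    proof (rule bdd[OF 1(1,2)])
      show "dist x' xb < d" "dist y (F xb) < d" "dist a' b < d"
        using 1 near dist_triangle_half_l[of x' "xs (k + N)" d xb] dist_triangle_half_l[of y "F (xs (k + N))" d "F xb"]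
          dist_triangle_half_l[of a' "a (k + N)" d b] by (auto simp: dist_commute)
      show "norm (adjoint_jacobian F x' u) \<le> norm vb + 2"
        using 1(6) near norm_triangle_sub[of "vs (k + N)" vb] by (simp add: dist_norm)
    qed
  qed blast
  then obtain us where us: "\<And>k. us k \<in> limiting_subdiff g (F (xs (k + N)))"
    and vus: "\<And>k. vs (k + N) = adjoint_jacobian F (xs (k + N)) (us k)" and M: "\<And>k. us k \<in> cball 0 M"
    by (metis mem_cball_0)
  obtain u s where u: "u \<in> cball 0 M" "strict_mono s" "(us \<circ> s) \<longlonglongrightarrow> u"
    by (rule seq_compactE[OF compact_imp_seq_compact[OF compact_cball], of us]) (use M in blast)
  \<comment> \<open>The shift by \<open>N\<close> and the subsequence are merged:
    \<open>us (s k)\<close> is a multiplier at index \<open>t k\<close>.\<close>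
  define t where "t k = s k + N" for k
  have t: "strict_mono t" using u(2) by (simp add: t_def strict_mono_def)
  have lim': "(\<lambda>k. xs (t k)) \<longlonglongrightarrow> xb" "(\<lambda>k. vs (t k)) \<longlonglongrightarrow> vb" "(\<lambda>k. zs (t k)) \<longlonglongrightarrow> xb"
    "(\<lambda>k. F (xs (t k))) \<longlonglongrightarrow> F xb" "(\<lambda>k. F (zs (t k))) \<longlonglongrightarrow> F xb" "(\<lambda>k. a (t k)) \<longlonglongrightarrow> b"
    using LIMSEQ_subseq_LIMSEQ[OF _ t] lim Fx Fz alim unfolding comp_def by blast+
  have us': "us (s k) \<in> limiting_subdiff g (F (xs (t k)))"
    and vus': "vs (t k) = adjoint_jacobian F (xs (t k)) (us (s k))" for k
    using us vus by (auto simp: t_def)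
  have ulim: "(\<lambda>k. us (s k)) \<longlonglongrightarrow> u" using u(3) by (simp add: comp_def)
  \<comment> \<open>Which multiplier of \<open>vb\<close> arises as the limit is not known
    beforehand; hence \<open>supp\<close> is assumed for all of them.\<close>
  have "u \<in> limiting_subdiff g (F xb)"
    by (rule limiting_subdiff_closed[OF us' lim'(4) _ ulim]) (use lim'(6) a b in simp_all)
  moreover have "vb = adjoint_jacobian F xb u"
    using LIMSEQ_unique[OF lim'(2)] tendsto_adjoint_jacobian[OF F lim'(1) ulim] vus' by simp
  ultimately have "local_support g (F xb) u" by (rule supp)
  then obtain U1 V1 \<epsilon>1 where "open U1" "F xb \<in> U1" "open V1" "u \<in> V1" "\<epsilon>1 > 0"
    and "\<forall>x v y. v \<in> limiting_subdiff g x \<longrightarrow> x \<in> sublevel_nbhd g (F xb) U1 \<epsilon>1 \<longrightarrow> v \<in> V1 \<longrightarrow>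
       y \<in> U1 \<longrightarrow> g x + ereal (v \<bullet> (y - x)) \<le> g y"
    unfolding local_support_def by (elim exE conjE) (rule that; assumption)
  note UV1 = this(1-5) and ineq = this(6)[rule_format]
  have "\<forall>\<^sub>F k in sequentially. F (xs (t k)) \<in> U1 \<and> F (zs (t k)) \<in> U1 \<and> us (s k) \<in> V1 \<and>
      a (t k) < b + \<epsilon>1 \<and> xs (t k) \<in> U \<and> zs (t k) \<in> U \<and> vs (t k) \<in> V \<and> a (t k) < b + \<epsilon>"
    using topological_tendstoD[OF lim'(4) UV1(1,2)] topological_tendstoD[OF lim'(5) UV1(1,2)]
      topological_tendstoD[OF ulim UV1(3,4)] order_tendstoD(2)[OF lim'(6), of "b + \<epsilon>1"] UV1(5)
      topological_tendstoD[OF lim'(1) U] topological_tendstoD[OF lim'(3) U]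
      topological_tendstoD[OF lim'(2) V] order_tendstoD(2)[OF lim'(6), of "b + \<epsilon>"] \<epsilon>
    by (simp add: eventually_conj_iff)
  then obtain k where k: "F (xs (t k)) \<in> U1" "F (zs (t k)) \<in> U1" "us (s k) \<in> V1"
      "a (t k) < b + \<epsilon>1" "xs (t k) \<in> U" "zs (t k) \<in> U" "vs (t k) \<in> V" "a (t k) < b + \<epsilon>"
    using eventually_happens by force
  have "convex_on U (\<lambda>y. us (s k) \<bullet> F y)"
  proof (rule conv)
    show "xs (t k) \<in> sublevel_nbhd (g \<circ> F) xb U \<epsilon>"
      using k a b by (simp add: sublevel_nbhd_def)
  qed (use k(7) us' vs[of "t k"] in \<open>simp_all only: vus'\<close>)
  moreover have "((\<lambda>y. us (s k) \<bullet> F y) has_derivative (\<lambda>h. vs (t k) \<bullet> h)) (at (xs (t k)))"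
    unfolding vus' inner_adjoint_jacobian by (intro derivative_intros C1_mapping_has_derivative[OF F])
  \<comment> \<open>The increment along \<open>vs (t k)\<close> is dominated by the increment of
    \<open>F\<close> along \<open>us (s k)\<close>, to which the support inequality of
    \<open>g\<close> applies.\<close>
  ultimately have "us (s k) \<bullet> F (xs (t k)) + vs (t k) \<bullet> (zs (t k) - xs (t k)) \<le> us (s k) \<bullet> F (zs (t k))"
    using k by (intro convex_on_gradient_ineq)
  then have "g (F (xs (t k))) + ereal (vs (t k) \<bullet> (zs (t k) - xs (t k)))
      \<le> g (F (xs (t k))) + ereal (us (s k) \<bullet> (F (zs (t k)) - F (xs (t k))))"
    unfolding a by (simp add: inner_diff_right)
  also have "\<dots> \<le> g (F (zs (t k)))"
    by (rule ineq[OF us']) (use k a b in \<open>simp_all add: sublevel_nbhd_def\<close>)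
  finally show False using bad[of "t k"] by simp
qed

theorem theorem4p2:
  fixes g :: "real ^ 'm \<Rightarrow> ereal"
    and F :: "real ^ 'n \<Rightarrow> real ^ 'm"
    and f :: "real ^ 'n \<Rightarrow> ereal"
    and xb vb :: "real ^ 'n"
    and U V :: "(real ^ 'n) set"
    and \<epsilon> :: real
  assumes "proper_fun g" and "lsc_fun g"
    and "C1_mapping F"
    and "f = g \<circ> F"
    and "F xb \<in> eff_dom g"
    and "vb \<in> limiting_subdiff f xb"
    and "\<And>ub. ub \<in> limiting_subdiff g (F xb) \<Longrightarrow> vb = transpose (jacobian F (at xb)) *v ub
           \<Longrightarrow> variationally_convex g (F xb) ub"
    and "{u. transpose (jacobian F (at xb)) *v u = 0} \<inter> horizon_subdiff g (F xb) = {0}"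
    and "open U" and "convex U" and "xb \<in> U"
    and "open V" and "convex V" and "vb \<in> V"
    and "\<epsilon> > 0"
    and "\<And>x v u. (x, v) \<in> gph_subdiff f \<inter> (sublevel_nbhd f xb U \<epsilon> \<times> V) \<Longrightarrow>
           u \<in> multiplier_map g F (x, v) \<Longrightarrow> convex_on U (\<lambda>y. u \<bullet> F y)"
  shows "variationally_convex f xb vb"
proof -
  have g: "g y \<noteq> -\<infinity>" for y using assms(1) unfolding proper_fun_def by (metis less_irrefl)
  obtain b where b: "g (F xb) = ereal b"
    using assms(5) g[of "F xb"] unfolding eff_dom_def by (cases "g (F xb)") auto
  have "local_support (g \<circ> F) xb vb"
  proof (rule local_support_compose[where U = U and V = V and \<epsilon> = \<epsilon>])
    fix w assume "w \<in> horizon_subdiff g (F xb)" "transpose (jacobian F (at xb)) *v w = 0"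
    then have "w \<in> {u. transpose (jacobian F (at xb)) *v u = 0} \<inter> horizon_subdiff g (F xb)"
      by simp
    then show "w = 0" unfolding assms(8) by simp
  next
    fix x u assume 1: "x \<in> sublevel_nbhd (g \<circ> F) xb U \<epsilon>" "transpose (jacobian F (at x)) *v u \<in> V"
      "transpose (jacobian F (at x)) *v u \<in> limiting_subdiff (g \<circ> F) x" "u \<in> limiting_subdiff g (F x)"
    \<comment> \<open>Taking \<open>v\<close> to be the pullback of \<open>u\<close> makes
      \<open>u\<close> a member of \<open>multiplier_map g F (x, v)\<close> by definition.\<close>
    show "convex_on U (\<lambda>y. u \<bullet> F y)"
      by (rule assms(16)[of x "transpose (jacobian F (at x)) *v u"])
         (use 1 in \<open>simp_all add: assms(4) gph_subdiff_def multiplier_map_def\<close>)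
  qed (use g b assms variationally_convex_imp_local_support in blast)+
  moreover have "proper_fun f"
    using g b unfolding proper_fun_def assms(4) by (auto intro!: exI[of _ xb])
  moreover have "lsc_fun f"
    unfolding assms(4) by (intro lsc_fun_compose C1_mapping_continuous assms)
  ultimately show ?thesis
    using assms(4,6) by (intro local_support_imp_variationally_convex) simp_all
qed

end
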